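(* Consider the Bellman equation, for $s\in\mathcal{M}$ and $z\in\mathbb{N}\cup\{0\}$, $$V(s,z)=\min_{u\in\{1,2,3\}}\Big(\hat c(s,z,u)+\beta\,\mathbb{E}\big[V(\hat f(s,z,u,o))\big]\Big),$$ where the expectation is over the observation $o\in\mathcal{M}\cup\{\mathtt{blank}\}$ with the conditional probability $$q(o\mid s,z,u)=\mathbb{1}(u=1,o=\mathtt{blank})+\mathbb{1}(u=2)\,T_{\mathsf m}^{1+z}(o,s)+\mathbb{1}(u=3,o=0).$$ The optimal strategy for the cost $J(g)=\mathbb{E}\big[\sum_{t=1}^\infty\beta^{t-1}c(m_t,u_t)\big]$ is obtained by solving this equation; that is, the equation admits a bounded solution $V$, and for any bounded solution $V$, any strategy that at each time $t$ chooses $u_t$ as a minimizer of the right-hand side at $(s,z)=(s_t,z_t)$ minimizes $J$ over all strategies $g$.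
   Context: Notation: $\mathbb{N}=\{1,2,\ldots\}$, $\mathbb{1}(\cdot)$ is the indicator function, $x_{a:b}=(x_a,\ldots,x_b)$. $\mathrm{binopdf}(y,N,q)=\binom{N}{y}q^y(1-q)^{N-y}$ is the binomial probability of $y$ successes in $N$ trials with success probability $q$ (with $0^0=1$; it is $0$ for $y\notin\{0,\ldots,N\}$). Model: Let $n\in\mathbb{N}$, $p\in[0,1]$, $\beta\in(0,1)$. There are $n$ components; $x^i_t\in\{0,1\}$ is the state of component $i$ at time $t\in\mathbb{N}$ ($0$ = operating, $1$ = faulty). The action at time $t$ is $u_t\in\mathcal{U}=\{1,2,3\}$ (1 = do nothing, 2 = inspect, 3 = repair). Given the whole past (states and actions up to time $t$), the next states $x^1_{t+1},\ldots,x^n_{t+1}$ are independent, with $\mathbb{P}(x^i_{t+1}=1\mid x^i_t=0,u_t\in\{1,2\})=p$, $\mathbb{P}(x^i_{t+1}=1\mid x^i_t=1,u_t\in\{1,2\})=1$, $\mathbb{P}(x^i_{t+1}=1\mid x^i_t,u_t=3)=0$. The number of faulty components is $m_t=\sum_{i=1}^n x^i_t\in\mathcal{M}=\{0,\ldots,n\}$, with $m_1=0$. The observation $o_t\in\mathcal{O}=\mathcal{M}\cup\{\mathtt{blank}\}$ satisfies $o_1=0$, and: if $u_t=1$ then $o_{t+1}=\mathtt{blank}$; if $u_t=2$ then $o_{t+1}=m_{t+1}$; if $u_t=3$ then $o_{t+1}=0$. A strategy $g$ maps the information available at time $t$ to an action: $u_t=g(o_{1:t},u_{1:t-1})$. The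 per-step cost is a function $c:\mathcal{M}\times\mathcal{U}\to\mathbb{R}$. Information state: $s_t\in\mathcal{M}$ is the last non-blank observation up to and including time $t$, and $z_t\in\mathbb{N}\cup\{0\}$ is the time elapsed between that observation and $t$; so $(s_1,z_1)=(0,0)$. Define $\hat f(s,z,u,o)=(s,1+z)$ if $u=1$, $(o,0)$ if $u=2$, $(0,0)$ if $u=3$. Transition matrix under actions $\{1,2\}$: $T_{\mathsf m}(m',m)=\mathbb{P}(m_{t+1}=m'\mid m_t=m,u_t\in\{1,2\})$ for $m',m\in\mathcal{M}$, i.e. $T_{\mathsf m}(m',0)=\mathrm{binopdf}(m',n,p)$, $T_{\mathsf m}(m',n)=\mathbb{1}(m'=n)$, and for $0<m<n$, $T_{\mathsf m}(m',m)=\sum_{j=0}^{m'}\mathrm{binopdf}(j,m,1)\,\mathrm{binopdf}(m'-j,n-m,p)$. $T_{\mathsf m}^{j}$ is the $j$-th matrix power ($T_{\mathsf m}^0$ the identity), and $T_{\mathsf m}^{j}(\mathtt{blank},s)$ is read as $0$. Define $\hat c(s,z,u)=\sum_{m\in\mathcal{M}}c(m,u)\,T_{\mathsf m}^{z}(m,s)$. *)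

theory Defs
  imports "HOL-Probability.Probability" "Jordan_Normal_Form.Matrix"
begin

(* The actions 1, 2, 3 in this order. *)
datatype action = DoNothing | Inspect | Repair

datatype obs = Blank | Count (the_count: nat)

(* Time is shifted by one throughout: index t = 0, 1, 2, ... stands for time t + 1.
   A joint state is an extensional function on {1..n}; True means faulty. *)

definition states :: "nat \<Rightarrow> (nat \<Rightarrow> bool) measure" where
  "states n = PiM {1..n} (\<lambda>_. count_space UNIV)"

definition num_faulty :: "nat \<Rightarrow> (nat \<Rightarrow> bool) \<Rightarrow> nat" where
  "num_faulty n x = (\<Sum>i=1..n. of_bool (x i))"

fun observe :: "action \<Rightarrow> nat \<Rightarrow> obs" where
  "observe DoNothing m = Blank"
| "observe Inspect m = Count m"
| "observe Repair m = Count 0"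

(* A strategy receives the observations up to now and the actions before now,
   both in chronological order; the current time is implicit in their lengths. *)
type_synonym strategy = "obs list \<Rightarrow> action list \<Rightarrow> action"

(* (o_{1:t}, u_{1:t-1}) along a given path of joint states *)
primrec info :: "nat \<Rightarrow> strategy \<Rightarrow> (nat \<Rightarrow> nat \<Rightarrow> bool) \<Rightarrow> nat \<Rightarrow> obs list \<times> action list" where
  "info n g \<omega> 0 = ([Count 0], [])"
| "info n g \<omega> (Suc t) =
    (let (os, us) = info n g \<omega> t; u = g os us
     in (os @ [observe u (num_faulty n (\<omega> (Suc t)))], us @ [u]))"

definition act :: "nat \<Rightarrow> strategy \<Rightarrow> (nat \<Rightarrow> nat \<Rightarrow> bool) \<Rightarrow> nat \<Rightarrow> action" where
  "act n g \<omega> t = (case info n g \<omega> t of (os, us) \<Rightarrow> g os us)"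

definition component_step :: "real \<Rightarrow> bool \<Rightarrow> action \<Rightarrow> bool pmf" where
  "component_step p x u =
    (if u = Repair then return_pmf False
     else if x then return_pmf True
     else bernoulli_pmf p)"

(* Conditional law of the joint state at index t given the path before t.
   The past actions are determined by the past states through the strategy. *)
fun step_kernel :: "nat \<Rightarrow> real \<Rightarrow> strategy \<Rightarrow> nat \<Rightarrow> (nat \<Rightarrow> nat \<Rightarrow> bool) \<Rightarrow> (nat \<Rightarrow> bool) measure" where
  "step_kernel n p g 0 \<omega> = return (states n) (\<lambda>i\<in>{1..n}. False)"
| "step_kernel n p g (Suc t) \<omega> =
    PiM {1..n} (\<lambda>i. measure_pmf (component_step p (\<omega> t i) (act n g \<omega> t)))"

(* The law of the path of joint states under g, i.e. the limit measure of the
   Ionescu-Tulcea theorem for the above kernels. *)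
definition path_measure :: "nat \<Rightarrow> real \<Rightarrow> strategy \<Rightarrow> (nat \<Rightarrow> nat \<Rightarrow> bool) measure" where
  "path_measure n p g =
    projective_family.lim UNIV (Ionescu_Tulcea.CI (step_kernel n p g) (\<lambda>_. states n)) (\<lambda>_. states n)"

definition cost ::
  "nat \<Rightarrow> real \<Rightarrow> real \<Rightarrow> (nat \<Rightarrow> action \<Rightarrow> real) \<Rightarrow> strategy \<Rightarrow> real" where
  "cost n p \<beta> c g =
    (\<integral>\<omega>. (\<Sum>t. \<beta> ^ t * c (num_faulty n (\<omega> t)) (act n g \<omega> t)) \<partial>path_measure n p g)"

definition last_obs :: "obs list \<Rightarrow> nat" where
  "last_obs os = the_count (last (filter (\<lambda>ob. ob \<noteq> Blank) os))"

definition elapsed :: "obs list \<Rightarrow> nat" where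
  "elapsed os = length (takeWhile (\<lambda>ob. ob = Blank) (rev os))"

fun f_hat :: "nat \<Rightarrow> nat \<Rightarrow> action \<Rightarrow> obs \<Rightarrow> nat \<times> nat" where
  "f_hat s z DoNothing ob = (s, 1 + z)"
| "f_hat s z Inspect ob = (the_count ob, 0)"
| "f_hat s z Repair ob = (0, 0)"

definition binopdf :: "nat \<Rightarrow> nat \<Rightarrow> real \<Rightarrow> real" where
  "binopdf y N q = real (N choose y) * q ^ y * (1 - q) ^ (N - y)"

(* Columns are indexed by the current, rows by the next number of faulty components. *)
definition T_m :: "nat \<Rightarrow> real \<Rightarrow> real Matrix.mat" where
  "T_m n p = Matrix.mat (Suc n) (Suc n) (\<lambda>(m', m).
    if m = 0 then binopdf m' n p
    else if m = n then of_bool (m' = n)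
    else (\<Sum>j=0..m'. binopdf j m 1 * binopdf (m' - j) (n - m) p))"

definition c_hat ::
  "nat \<Rightarrow> real \<Rightarrow> (nat \<Rightarrow> action \<Rightarrow> real) \<Rightarrow> nat \<Rightarrow> nat \<Rightarrow> action \<Rightarrow> real" where
  "c_hat n p c s z u = (\<Sum>m=0..n. c m u * (T_m n p ^\<^sub>m z) $$ (m, s))"

definition obs_prob :: "nat \<Rightarrow> real \<Rightarrow> obs \<Rightarrow> nat \<Rightarrow> nat \<Rightarrow> action \<Rightarrow> real" where
  "obs_prob n p ob s z u =
    of_bool (u = DoNothing \<and> ob = Blank)
    + of_bool (u = Inspect) *
        (case ob of Blank \<Rightarrow> 0 | Count k \<Rightarrow> (T_m n p ^\<^sub>m (1 + z)) $$ (k, s))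
    + of_bool (u = Repair \<and> ob = Count 0)"

(* The term for ob = Blank, u = Inspect has probability 0, so the unspecified
   value of f_hat there is irrelevant. *)
definition bellman_rhs ::
  "nat \<Rightarrow> real \<Rightarrow> real \<Rightarrow> (nat \<Rightarrow> action \<Rightarrow> real) \<Rightarrow> (nat \<times> nat \<Rightarrow> real)
    \<Rightarrow> nat \<Rightarrow> nat \<Rightarrow> action \<Rightarrow> real" where
  "bellman_rhs n p \<beta> c V s z u =
    c_hat n p c s z u
    + \<beta> * (\<Sum>ob \<in> insert Blank (Count ` {0..n}). obs_prob n p ob s z u * V (f_hat s z u ob))"

(* V is a function on {0..n} x nat; its values elsewhere are irrelevant. *)
definition bounded_bellman_solution ::
  "nat \<Rightarrow> real \<Rightarrow> real \<Rightarrow> (nat \<Rightarrow> action \<Rightarrow> real) \<Rightarrow> (nat \<times> nat \<Rightarrow> real) \<Rightarrow> bool" where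
  "bounded_bellman_solution n p \<beta> c V \<longleftrightarrow>
    bounded (V ` ({0..n} \<times> UNIV)) \<and>
    (\<forall>s\<in>{0..n}. \<forall>z. V (s, z) =
      (MIN u \<in> {DoNothing, Inspect, Repair}. bellman_rhs n p \<beta> c V s z u))"

definition chooses_minimizer ::
  "nat \<Rightarrow> real \<Rightarrow> real \<Rightarrow> (nat \<Rightarrow> action \<Rightarrow> real) \<Rightarrow> (nat \<times> nat \<Rightarrow> real) \<Rightarrow> strategy \<Rightarrow> bool" where
  "chooses_minimizer n p \<beta> c V g \<longleftrightarrow>
    (AE \<omega> in path_measure n p g. \<forall>t.
      let os = fst (info n g \<omega> t); s = last_obs os; z = elapsed os
      in is_arg_min (bellman_rhs n p \<beta> c V s z) (\<lambda>u. u \<in> {DoNothing, Inspect, Repair})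
           (act n g \<omega> t))"

(* Well-definedness of path_measure: it is a probability measure under which the
   components have the prescribed conditional law given the past. *)

lemma finite_joint_states: "finite (PiE {1..n::nat} (\<lambda>_. UNIV :: bool set))"
  by (rule finite_PiE) simp_all

lemma states_eq: "states n = count_space (PiE {1..n} (\<lambda>_. UNIV))"
  unfolding states_def by (rule count_space_PiM_finite) simp_all

lemma space_states: "space (states n) = PiE {1..n} (\<lambda>_. UNIV)"
  by (simp add: states_eq)

lemma PiM_states_eq:
  "finite I \<Longrightarrow> PiM I (\<lambda>_. states n) = count_space (PiE I (\<lambda>_. PiE {1..n} (\<lambda>_. UNIV)))"
  unfolding states_eq
  by (rule count_space_PiM_finite) (auto intro: countable_finite finite_joint_states[simplified])

lemma info_cong: "(\<And>s. s \<le> t \<Longrightarrow> \<omega> s = \<omega>' s) \<Longrightarrow> info n g \<omega> t = info n g \<omega>' t"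
  by (induction t) auto

lemma act_cong: "(\<And>s. s \<le> t \<Longrightarrow> \<omega> s = \<omega>' s) \<Longrightarrow> act n g \<omega> t = act n g \<omega>' t"
  unfolding act_def using info_cong[of t \<omega> \<omega>' n g] by simp

lemma sets_step_kernel: "sets (step_kernel n p g t \<omega>) = sets (states n)"
  by (cases t) (auto simp: states_def intro!: sets_PiM_cong)

lemma prob_space_step_kernel: "prob_space (step_kernel n p g t \<omega>)"
proof (cases t)
  case 0
  then show ?thesis by (auto intro!: prob_space_return simp: space_states)
next
  case (Suc t')
  then show ?thesis by (auto intro!: prob_space_PiM measure_pmf.prob_space_axioms)
qed

lemma Ionescu_Tulcea_step_kernel: "Ionescu_Tulcea (step_kernel n p g) (\<lambda>_. states n)"
proof (rule Ionescu_Tulcea.intro)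
  show "step_kernel n p g t \<in> measurable (PiM {0..<t} (\<lambda>_. states n)) (subprob_algebra (states n))" for t
    by (auto simp: PiM_states_eq space_subprob_algebra sets_step_kernel
        intro!: prob_space_imp_subprob_space prob_space_step_kernel)
qed (rule prob_space_step_kernel)

lemma sets_path_measure: "sets (path_measure n p g) = sets (PiM UNIV (\<lambda>_. states n))"
proof -
  interpret Ionescu_Tulcea "step_kernel n p g" "\<lambda>_. states n" by (rule Ionescu_Tulcea_step_kernel)
  show ?thesis unfolding path_measure_def by (rule PF.sets_lim)
qed

lemma space_path_measure: "space (path_measure n p g) = space (PiM UNIV (\<lambda>_. states n))"
  by (rule sets_eq_imp_space_eq[OF sets_path_measure])

lemma prob_space_path_measure: "prob_space (path_measure n p g)"
proof -
  interpret Ionescu_Tulcea "step_kernel n p g" "\<lambda>_. states n" by (rule Ionescu_Tulcea_step_kernel)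
  interpret A: prob_space "CI {}" by (rule PF.prob_space_P) auto
  have "prob_space (distr PF.lim (PiM {} (\<lambda>_. states n)) (\<lambda>x. restrict x {}))"
    using distr_lim[of "{}"] A.prob_space_axioms by simp
  then have "prob_space PF.lim"
    by (rule prob_space_distrD[rotated])
       (auto intro!: measurable_restrict simp: measurable_cong_sets[OF PF.sets_lim refl])
  then show ?thesis unfolding path_measure_def .
qed

lemma emeasure_path_measure_cylinder:
  assumes h: "\<And>s. s < Suc k \<Longrightarrow> h s \<in> space (states n)"
  shows "emeasure (path_measure n p g) {\<omega> \<in> space (path_measure n p g). \<forall>s<Suc k. \<omega> s = h s} =
    emeasure (path_measure n p g) {\<omega> \<in> space (path_measure n p g). \<forall>s<k. \<omega> s = h s} *
    emeasure (step_kernel n p g k h) {h k}"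
proof -
  interpret Ionescu_Tulcea "step_kernel n p g" "\<lambda>_. states n" by (rule Ionescu_Tulcea_step_kernel)
  have cyl: "emeasure (path_measure n p g) {\<omega> \<in> space (path_measure n p g). \<forall>s<j. \<omega> s = h s} =
      emeasure (C 0 j (\<lambda>_. undefined)) {restrict h {0..<j}}" if "j \<le> Suc k" for j
  proof -
    have X: "{restrict h {0..<j}} \<in> sets (PiM {0..<j} (\<lambda>_. states n))"
      using h that by (auto simp: PiM_states_eq space_states)
    have "restrict \<omega> {0..<j} = restrict h {0..<j} \<longleftrightarrow> (\<forall>s<j. \<omega> s = h s)" for \<omega>
      by (metis atLeastLessThan_iff le0 restrict_apply' restrict_ext)
    then have eq: "{\<omega> \<in> space (path_measure n p g). \<forall>s<j. \<omega> s = h s} =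
        PF.emb UNIV {0..<j} {restrict h {0..<j}}"
      unfolding space_path_measure prod_emb_def
      by (auto simp: space_PiM)
    have "emeasure (path_measure n p g) {\<omega> \<in> space (path_measure n p g). \<forall>s<j. \<omega> s = h s} =
        emeasure (CI {0..<j}) {restrict h {0..<j}}"
      unfolding eq unfolding path_measure_def by (rule lim[OF _ X]) simp
    also have "\<dots> = emeasure (C 0 j (\<lambda>_. undefined)) {restrict h {0..<j}}"
      using emeasure_CI[of "{0..<j}" j, OF _ X] sets.sets_into_space[OF X]
      by (simp add: prod_emb_id space_PiM)
    finally show ?thesis .
  qed
  have ker: "step_kernel n p g k (restrict h {0..<k}) = step_kernel n p g k h"
  proof (cases k)
    case (Suc t)
    then have "act n g (restrict h {0..<k}) t = act n g h t"
      by (intro act_cong) auto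
    then show ?thesis using Suc by simp
  qed simp
  let ?h = "restrict h {0..<k}" and ?h' = "restrict h {0..<Suc k}"
  have X': "{?h'} \<in> sets (PiM {0..<Suc k} (\<lambda>_. states n))"
    using h by (auto simp: PiM_states_eq space_states)
  have X: "{?h} \<in> sets (PiM {0..<k} (\<lambda>_. states n))"
    using h by (auto simp: PiM_states_eq space_states)
  have eP: "emeasure (eP k \<omega>) {?h'} = emeasure (step_kernel n p g k h) {h k} * indicator {?h} \<omega>"
    if \<omega>: "\<omega> \<in> space (PiM {0..<k} (\<lambda>_. states n))" for \<omega>
  proof -
    have ext: "\<omega> s = undefined" if "\<not> s < k" for s
      using \<omega> that by (auto simp: space_PiM PiE_iff extensional_def)
    have upd: "fun_upd \<omega> k x = ?h' \<longleftrightarrow> \<omega> = ?h \<and> x = h k" for x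
    proof
      assume eq: "fun_upd \<omega> k x = ?h'"
      have "\<omega> s = ?h s" for s
        using fun_cong[OF eq, of s] ext[of s] by (cases "s < k") auto
      moreover have "x = h k" using fun_cong[OF eq, of k] by simp
      ultimately show "\<omega> = ?h \<and> x = h k" by auto
    qed (auto simp: fun_eq_iff)
    have "emeasure (eP k \<omega>) {?h'} =
        emeasure (step_kernel n p g k \<omega>) ((\<lambda>x. fun_upd \<omega> k x) -` {?h'} \<inter> space (states n))"
      by (rule emeasure_eP[OF \<omega> X'])
    also have "(\<lambda>x. fun_upd \<omega> k x) -` {?h'} \<inter> space (states n) = (if \<omega> = ?h then {h k} else {})"
    proof (rule Set.set_eqI)
      fix x
      have "x = h k \<Longrightarrow> x \<in> space (states n)" using h[of k] by simp
      then show "x \<in> (\<lambda>x. fun_upd \<omega> k x) -` {?h'} \<inter> space (states n) \<longleftrightarrow>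
          x \<in> (if \<omega> = ?h then {h k} else {})"
        unfolding Int_iff vimage_singleton_eq upd by (simp only: singleton_iff empty_iff split: if_split) blast
    qed
    finally have *: "emeasure (eP k \<omega>) {?h'} =
        emeasure (step_kernel n p g k \<omega>) (if \<omega> = ?h then {h k} else {})" .
    show ?thesis
      by (subst *) (simp add: ker indicator_def)
  qed
  have sp: "(\<lambda>_. undefined) \<in> space (PiM {0..<0::nat} (\<lambda>_. states n))"
    by (simp add: space_PiM)
  have "emeasure (C 0 (Suc k) (\<lambda>_. undefined)) {?h'} =
      (\<integral>\<^sup>+\<omega>. emeasure (eP k \<omega>) {?h'} \<partial>C 0 k (\<lambda>_. undefined))"
    using X' space_C[OF sp, of k] measurable_eP[of k] sets_C[OF sp, of k]
    by (subst C.simps, subst emeasure_bind[where N = "PiM {0..<Suc k} (\<lambda>_. states n)"])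
       (auto simp: space_PiM_empty_iff cong: measurable_cong_sets)
  also have "\<dots> = (\<integral>\<^sup>+\<omega>. emeasure (step_kernel n p g k h) {h k} * indicator {?h} \<omega>
      \<partial>C 0 k (\<lambda>_. undefined))"
    using space_C[OF sp, of k] by (intro nn_integral_cong eP) simp
  also have "\<dots> = emeasure (step_kernel n p g k h) {h k} * emeasure (C 0 k (\<lambda>_. undefined)) {?h}"
    using X sets_C[OF sp, of k] by (intro nn_integral_cmult_indicator) simp
  finally show ?thesis
    using cyl[of k] cyl[of "Suc k"] by (simp add: mult.commute)
qed

lemma path_measure_initial:
  "AE \<omega> in path_measure n p g. \<omega> 0 = (\<lambda>i\<in>{1..n}. False)"
proof -
  interpret prob_space "path_measure n p g" by (rule prob_space_path_measure)
  let ?z = "\<lambda>i\<in>{1..n}. False"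
  have z: "?z \<in> space (states n)" by (auto simp: space_states)
  have "emeasure (path_measure n p g) {\<omega> \<in> space (path_measure n p g). \<omega> 0 = ?z} = 1"
    using emeasure_path_measure_cylinder[of 0 "\<lambda>_. ?z" n p g] z emeasure_space_1
    by (simp add: states_eq)
  moreover from this have "{\<omega> \<in> space (path_measure n p g). \<omega> 0 = ?z} \<in> events"
    using emeasure_notin_sets by fastforce
  ultimately show ?thesis
    by (intro AE_I_eq_1)
qed

lemma path_measure_conditional_law:
  assumes h: "\<And>s. s \<le> Suc t \<Longrightarrow> h s \<in> space (states n)"
  shows "measure (path_measure n p g)
      {\<omega> \<in> space (path_measure n p g). \<forall>s\<le>Suc t. \<omega> s = h s} =
    measure (path_measure n p g) {\<omega> \<in> space (path_measure n p g). \<forall>s\<le>t. \<omega> s = h s} *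
    (\<Prod>i=1..n. pmf (component_step p (h t i) (act n g h t)) (h (Suc t) i))"
proof -
  have sing: "{h (Suc t)} = PiE {1..n} (\<lambda>i. {h (Suc t) i})"
    using h[of "Suc t"] by (auto simp: space_states PiE_singleton PiE_iff)
  interpret product_prob_space "\<lambda>i. measure_pmf (component_step p (h t i) (act n g h t))" "{1..n}"
    by standard
  have "emeasure (step_kernel n p g (Suc t) h) {h (Suc t)} =
      (\<Prod>i=1..n. emeasure (measure_pmf (component_step p (h t i) (act n g h t))) {h (Suc t) i})"
    unfolding sing by (simp del: PiE_singleton, subst emeasure_PiM) auto
  also have "\<dots> = ennreal (\<Prod>i=1..n. pmf (component_step p (h t i) (act n g h t)) (h (Suc t) i))"
    by (simp add: emeasure_pmf_single prod_ennreal)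
  finally show ?thesis
    using emeasure_path_measure_cylinder[of "Suc t" h n p g] h
    by (simp add: measure_def less_Suc_eq_le enn2real_mult prod_nonneg)
qed

end

theory Submission
  imports Defs
begin

text \<open>
  At every time the pair \<open>(s, z)\<close> of the last observed number of faulty components and
  the age of that observation determines the conditional law of the current number of faulty
  components given the whole information: it is column \<open>s\<close> of the \<open>z\<close>-th power of
  the transition matrix. The reason is that a repair or an inspection reveals the count and so
  resets the law to a point mass, while doing nothing applies the transition matrix once and
  reveals nothing. The lemma \<open>filter_expectation\<close> states this without conditional
  expectations: replacing the hidden count by this law does not change the expectation of any
  function of the count and the information. The induction behind it consists of the law of one
  step of the system (\<open>expectation_next_count\<close>), which is where the construction of the
  path measure enters, and of the consistency of the law with the update of the pair
  (\<open>belief_update\<close>).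

  Given this, the theorem follows by the usual verification argument for discounted problems. If
  \<open>V\<close> solves the Bellman equation and \<open>v t\<close> is the expectation of \<open>V\<close> at the
  information state at time \<open>t\<close>, then the filter turns the right-hand side of the equation
  into the expected stage cost plus \<open>\<beta> * v (Suc t)\<close>
  (\<open>expected_bellman_rhs\<close>). Hence \<open>v t\<close> is at most this value for every strategy, with
  equality for a strategy that chooses minimizers. Iterating over \<open>t\<close> and letting the
  discount kill the bounded remainder gives \<open>V (0, 0) \<le> J(g')\<close> for every
  \<open>g'\<close> and \<open>J(g) = V (0, 0)\<close> for a minimizing \<open>g\<close>. A bounded solution
  exists because the Bellman operator contracts the supremum norm by the factor
  \<open>\<beta>\<close>.
\<close>

section \<open>Transition probabilities of the number of faulty components\<close>

text \<open>The factor \<open>binopdf j m 1\<close> is a point mass at \<open>j = m\<close>: faulty components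
  stay faulty. The three cases of the matrix thus merge into one, the binomial law of the number
  of new failures among the \<open>n - m\<close> working components.\<close>

lemma T_m_entry:
  assumes "m \<le> n" "m' \<le> n"
  shows "T_m n p $$ (m', m) =
    (if m \<le> m' then real ((n - m) choose (m' - m)) * p ^ (m' - m) * (1 - p) ^ (n - m') else 0)"
proof -
  have point: "binopdf j m 1 = of_bool (j = m)" for j
    by (cases "j < m"; cases "j = m") (auto simp: binopdf_def)
  consider "m = 0" | "m = n" "m \<noteq> 0" | "0 < m" "m < n" using assms by linarith
  then show ?thesis
  proof cases
    case 1
    then show ?thesis using assms by (simp add: T_m_def binopdf_def)
  next
    case 2
    then show ?thesis using assms by (simp add: T_m_def)
  next
    case 3
    have "(\<Sum>j=0..m'. binopdf j m 1 * binopdf (m' - j) (n - m) p) =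
        (\<Sum>j=0..m'. if j = m then binopdf (m' - m) (n - m) p else 0)"
      by (rule sum.cong) (auto simp: point)
    then show ?thesis using 3 assms by (simp add: T_m_def binopdf_def sum.delta)
  qed
qed

lemma T_m_entry_nonneg:
  assumes "0 \<le> p" "p \<le> 1" "m \<le> n" "m' \<le> n"
  shows "0 \<le> T_m n p $$ (m', m)"
  using assms by (simp add: T_m_entry)

lemma T_m_column_sum:
  assumes "m \<le> n"
  shows "(\<Sum>m'=0..n. T_m n p $$ (m', m)) = 1"
proof -
  have "(\<Sum>m'=0..n. T_m n p $$ (m', m)) =
      (\<Sum>m'\<in>{m..n}. real ((n - m) choose (m' - m)) * p ^ (m' - m) * (1 - p) ^ (n - m'))"
    using assms by (intro sum.mono_neutral_cong_right) (auto simp: T_m_entry)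
  also have "\<dots> = (\<Sum>k\<le>n - m. real ((n - m) choose k) * p ^ k * (1 - p) ^ (n - m - k))"
    using assms by (intro sum.reindex_bij_witness[of _ "\<lambda>k. k + m" "\<lambda>m'. m' - m"]) auto
  also have "\<dots> = (p + (1 - p)) ^ (n - m)"
    by (rule binomial_ring[symmetric])
  finally show ?thesis by simp
qed

lemma T_m_carrier: "T_m n p \<in> carrier_mat (Suc n) (Suc n)"
  by (simp add: T_m_def)

lemma T_m_pow_0:
  assumes "m \<le> n" "s \<le> n"
  shows "(T_m n p ^\<^sub>m 0) $$ (m, s) = of_bool (m = s)"
  using assms T_m_carrier[of n p] by simp

text \<open>Matrix powers multiply new factors from the right, whereas one more step of the system acts on
  the row index, from the left. Powers of one matrix commute, so both agree.\<close>

lemma T_m_pow_Suc: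
  assumes "m' \<le> n" "s \<le> n"
  shows "(T_m n p ^\<^sub>m Suc z) $$ (m', s) =
    (\<Sum>m=0..n. T_m n p $$ (m', m) * (T_m n p ^\<^sub>m z) $$ (m, s))"
proof -
  let ?A = "T_m n p"
  have pow: "?A ^\<^sub>m k \<in> carrier_mat (Suc n) (Suc n)" for k
    using T_m_carrier by (rule pow_carrier_mat)
  have comm: "?A ^\<^sub>m Suc k = ?A * ?A ^\<^sub>m k" for k
  proof (induction k)
    case (Suc k)
    have "?A ^\<^sub>m Suc (Suc k) = (?A * ?A ^\<^sub>m k) * ?A"
      using Suc.IH by simp
    also have "\<dots> = ?A * (?A ^\<^sub>m k * ?A)"
      by (rule assoc_mult_mat[OF T_m_carrier pow T_m_carrier])
    finally show ?case by simp
  qed (use T_m_carrier[of n p] in simp)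
  have "(?A ^\<^sub>m Suc z) $$ (m', s) = row ?A m' \<bullet> col (?A ^\<^sub>m z) s"
    unfolding comm using pow[of z] T_m_carrier[of n p] assms by simp
  also have "\<dots> = (\<Sum>m=0..n. ?A $$ (m', m) * (?A ^\<^sub>m z) $$ (m, s))"
    using pow[of z] T_m_carrier[of n p] assms
    by (auto simp: scalar_prod_def atLeastLessThanSuc_atLeastAtMost intro!: sum.cong)
  finally show ?thesis .
qed

lemma T_m_pow_nonneg:
  assumes "0 \<le> p" "p \<le> 1" "s \<le> n" "m \<le> n"
  shows "0 \<le> (T_m n p ^\<^sub>m z) $$ (m, s)"
  using assms(4)
proof (induction z arbitrary: m)
  case 0
  then show ?case using assms(3) by (simp only: T_m_pow_0) simp
next
  case (Suc z)
  then show ?case using assms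
    by (simp only: T_m_pow_Suc) (auto intro!: sum_nonneg mult_nonneg_nonneg T_m_entry_nonneg)
qed

lemma T_m_pow_column_sum:
  assumes "s \<le> n"
  shows "(\<Sum>m=0..n. (T_m n p ^\<^sub>m z) $$ (m, s)) = 1"
proof (induction z)
  case 0
  have "(\<Sum>m=0..n. (T_m n p ^\<^sub>m 0) $$ (m, s)) = (\<Sum>m=0..n. if m = s then 1 else 0)"
    using assms by (intro sum.cong) (auto simp only: T_m_pow_0 atLeastAtMost_iff of_bool_def)
  then show ?case using assms by simp
next
  case (Suc z)
  have "(\<Sum>m'=0..n. (T_m n p ^\<^sub>m Suc z) $$ (m', s)) =
      (\<Sum>m'=0..n. \<Sum>m=0..n. T_m n p $$ (m', m) * (T_m n p ^\<^sub>m z) $$ (m, s))"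
    using assms by (intro sum.cong) (auto simp only: T_m_pow_Suc atLeastAtMost_iff)
  also have "\<dots> = (\<Sum>m=0..n. (\<Sum>m'=0..n. T_m n p $$ (m', m)) * (T_m n p ^\<^sub>m z) $$ (m, s))"
    by (subst sum.swap) (simp add: sum_distrib_right)
  also have "\<dots> = (\<Sum>m=0..n. (T_m n p ^\<^sub>m z) $$ (m, s))"
    by (intro sum.cong) (auto simp: T_m_column_sum)
  finally show ?case using Suc by simp
qed

text \<open>Indices as in the matrix: the next count comes before the current one.\<close>

definition count_kernel :: "nat \<Rightarrow> real \<Rightarrow> action \<Rightarrow> nat \<Rightarrow> nat \<Rightarrow> real" where
  "count_kernel n p u m' m = (if u = Repair then of_bool (m' = 0) else T_m n p $$ (m', m))"

lemma num_faulty_eq_card: "num_faulty n x = card {i\<in>{1..n}. x i}"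
  by (simp add: num_faulty_def Int_def)

lemma num_faulty_le: "num_faulty n x \<le> n"
proof -
  have "card {i\<in>{1..n}. x i} \<le> card {1..n}" by (intro card_mono) auto
  then show ?thesis by (simp add: num_faulty_eq_card)
qed

lemma card_sets_between:
  assumes "finite I" "F \<subseteq> I"
  shows "card {Y. F \<subseteq> Y \<and> Y \<subseteq> I \<and> card Y = k} =
    (if card F \<le> k then (card I - card F) choose (k - card F) else 0)"
proof (cases "card F \<le> k")
  case True
  have fin: "finite F" using assms finite_subset by blast
  have "bij_betw (\<lambda>Z. F \<union> Z) {Z. Z \<subseteq> I - F \<and> card Z = k - card F}
      {Y. F \<subseteq> Y \<and> Y \<subseteq> I \<and> card Y = k}"
  proof (rule bij_betw_byWitness[where f' = "\<lambda>Y. Y - F"])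
    show "(\<lambda>Z. F \<union> Z) ` {Z. Z \<subseteq> I - F \<and> card Z = k - card F} \<subseteq>
        {Y. F \<subseteq> Y \<and> Y \<subseteq> I \<and> card Y = k}"
    proof safe
      fix Z assume Z: "Z \<subseteq> I - F" "card Z = k - card F"
      have "finite Z" using Z(1) assms(1) by (meson finite_Diff finite_subset)
      then show "card (F \<union> Z) = k"
        using Z fin True by (subst card_Un_disjoint) auto
    qed (use assms in auto)
    show "(\<lambda>Y. Y - F) ` {Y. F \<subseteq> Y \<and> Y \<subseteq> I \<and> card Y = k} \<subseteq>
        {Z. Z \<subseteq> I - F \<and> card Z = k - card F}"
      using fin by (auto simp: card_Diff_subset)
  qed auto
  then have "card {Y. F \<subseteq> Y \<and> Y \<subseteq> I \<and> card Y = k} =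
      card {Z. Z \<subseteq> I - F \<and> card Z = k - card F}"
    by (rule bij_betw_same_card[symmetric])
  also have "\<dots> = card (I - F) choose (k - card F)"
    using assms by (intro n_subsets) auto
  also have "card (I - F) = card I - card F"
    using fin assms by (rule_tac card_Diff_subset)
  finally show ?thesis using True by simp
next
  case False
  then have "{Y. F \<subseteq> Y \<and> Y \<subseteq> I \<and> card Y = k} = {}"
    using assms by (auto dest: card_mono[OF finite_subset])
  then have "card {Y. F \<subseteq> Y \<and> Y \<subseteq> I \<and> card Y = k} = 0" by (simp only: card.empty)
  then show ?thesis using False by simp
qed

text \<open>Lumpability: although the components fail individually, the law of the next count depends on
  the joint state only through its count. A next joint state is identified with its set of faulty
  components. Without repair, this set must contain the currently faulty ones, all such sets of one
  size are equally likely, and \<open>card_sets_between\<close> counts them.\<close>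

lemma num_faulty_step_law:
  assumes p: "0 \<le> p" "p \<le> 1" and "m' \<le> n"
  shows "(\<Sum>y\<in>{y\<in>space (states n). num_faulty n y = m'}.
      \<Prod>i=1..n. pmf (component_step p (x i) u) (y i)) = count_kernel n p u m' (num_faulty n x)"
proof -
  let ?I = "{1..n}" and ?F = "{i\<in>{1..n}. x i}"
  let ?q = "\<lambda>Y i. pmf (component_step p (x i) u) (i \<in> Y)"
  have "(\<Sum>y\<in>{y\<in>space (states n). num_faulty n y = m'}.
      \<Prod>i=1..n. pmf (component_step p (x i) u) (y i)) =
      (\<Sum>Y\<in>{Y. Y \<subseteq> ?I \<and> card Y = m'}. \<Prod>i\<in>?I. ?q Y i)"
  proof (rule sum.reindex_bij_witness[where i = "\<lambda>Y. \<lambda>i\<in>?I. i \<in> Y" and j = "\<lambda>y. {i\<in>?I. y i}"])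
    fix y assume "y \<in> {y\<in>space (states n). num_faulty n y = m'}"
    then show "(\<lambda>i\<in>?I. i \<in> {i\<in>?I. y i}) = y"
      by (auto simp: space_states PiE_iff extensional_def fun_eq_iff)
  next
    fix Y assume "Y \<in> {Y. Y \<subseteq> ?I \<and> card Y = m'}"
    moreover from this have "{i\<in>?I. (\<lambda>i\<in>?I. i \<in> Y) i} = Y" by auto
    ultimately show "{i\<in>?I. (\<lambda>i\<in>?I. i \<in> Y) i} = Y"
      "(\<lambda>i\<in>?I. i \<in> Y) \<in> {y\<in>space (states n). num_faulty n y = m'}"
      by (simp_all only: space_states num_faulty_eq_card) auto
  qed (auto simp: num_faulty_eq_card intro!: prod.cong)
  also have "\<dots> = count_kernel n p u m' (num_faulty n x)"
  proof (cases "u = Repair")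
    case True
    have "(\<Prod>i\<in>?I. ?q Y i) = of_bool (Y = {})" if "Y \<subseteq> ?I" for Y
    proof (cases "Y = {}")
      case False
      then obtain i where "i \<in> Y" by blast
      then have "?q Y i = 0" "i \<in> ?I" using True that by (auto simp: component_step_def)
      then have "(\<Prod>i\<in>?I. ?q Y i) = 0" by (intro prod_zero) auto
      then show ?thesis using False by (simp only: of_bool_eq)
    qed (simp add: True component_step_def)
    then have "(\<Sum>Y\<in>{Y. Y \<subseteq> ?I \<and> card Y = m'}. \<Prod>i\<in>?I. ?q Y i) =
        (\<Sum>Y\<in>{Y. Y \<subseteq> ?I \<and> card Y = m'}. if Y = {} then 1 else 0)"
      by (intro sum.cong) auto
    also have "\<dots> = of_bool (m' = 0)"
      by (subst sum.delta) auto
    finally show ?thesis using True by (simp add: count_kernel_def)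
  next
    case False
    have q: "?q Y i = (if x i then of_bool (i \<in> Y) else if i \<in> Y then p else 1 - p)" for Y i
      using False p by (auto simp: component_step_def)
    have prod: "(\<Prod>i\<in>?I. ?q Y i) =
        (if ?F \<subseteq> Y then p ^ (m' - card ?F) * (1 - p) ^ (n - m') else 0)"
      if Y: "Y \<subseteq> ?I" "card Y = m'" for Y
    proof (cases "?F \<subseteq> Y")
      case True
      have fin: "finite Y" using Y(1) finite_subset by blast
      have "?I = ?F \<union> (Y - ?F) \<union> (?I - Y)" using True Y by auto
      then have "(\<Prod>i\<in>?I. ?q Y i) = (\<Prod>i\<in>?F \<union> (Y - ?F) \<union> (?I - Y). ?q Y i)"
        by (rule arg_cong)
      also have "\<dots> = (\<Prod>i\<in>?F \<union> (Y - ?F). ?q Y i) * (\<Prod>i\<in>?I - Y. ?q Y i)"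
        using True fin by (intro prod.union_disjoint) auto
      also have "(\<Prod>i\<in>?F \<union> (Y - ?F). ?q Y i) = (\<Prod>i\<in>?F. ?q Y i) * (\<Prod>i\<in>Y - ?F. ?q Y i)"
        using fin by (intro prod.union_disjoint) auto
      also have "(\<Prod>i\<in>?F. ?q Y i) = 1" using True unfolding q by (intro prod.neutral) auto
      also have "(\<Prod>i\<in>Y - ?F. ?q Y i) = (\<Prod>i\<in>Y - ?F. p)"
        using Y unfolding q by (intro prod.cong) auto
      also have "(\<Prod>i\<in>?I - Y. ?q Y i) = (\<Prod>i\<in>?I - Y. 1 - p)"
        using True unfolding q by (intro prod.cong) auto
      also have "(\<Prod>i\<in>Y - ?F. p) = p ^ (m' - card ?F)"
        using True Y by (simp add: card_Diff_subset)
      also have "(\<Prod>i\<in>?I - Y. 1 - p) = (1 - p) ^ (n - m')"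
        using Y fin by (simp add: card_Diff_subset)
      finally show ?thesis using True by simp
    next
      case not_sub: False
      then obtain i where "i \<in> ?I" "x i" "i \<notin> Y" by blast
      then have "\<exists>i\<in>?I. ?q Y i = 0" unfolding q by auto
      then have "(\<Prod>i\<in>?I. ?q Y i) = 0" by (intro prod_zero) auto
      then show ?thesis using not_sub by (simp only: if_False)
    qed
    have "(\<Sum>Y\<in>{Y. Y \<subseteq> ?I \<and> card Y = m'}. \<Prod>i\<in>?I. ?q Y i) =
        (\<Sum>Y\<in>{Y. ?F \<subseteq> Y \<and> Y \<subseteq> ?I \<and> card Y = m'}. p ^ (m' - card ?F) * (1 - p) ^ (n - m'))"
    proof (rule sum.mono_neutral_cong_right)
      show "finite {Y. Y \<subseteq> ?I \<and> card Y = m'}" by simp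
    next
      show "\<forall>Y\<in>{Y. Y \<subseteq> ?I \<and> card Y = m'} - {Y. ?F \<subseteq> Y \<and> Y \<subseteq> ?I \<and> card Y = m'}.
          (\<Prod>i\<in>?I. ?q Y i) = 0"
      proof
        fix Y assume "Y \<in> {Y. Y \<subseteq> ?I \<and> card Y = m'} - {Y. ?F \<subseteq> Y \<and> Y \<subseteq> ?I \<and> card Y = m'}"
        then have "Y \<subseteq> ?I" "card Y = m'" "\<not> ?F \<subseteq> Y" by blast+
        then show "(\<Prod>i\<in>?I. ?q Y i) = 0" by (simp only: prod if_False)
      qed
    next
      fix Y assume "Y \<in> {Y. ?F \<subseteq> Y \<and> Y \<subseteq> ?I \<and> card Y = m'}"
      then have "Y \<subseteq> ?I" "card Y = m'" "?F \<subseteq> Y" by blast+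
      then show "(\<Prod>i\<in>?I. ?q Y i) = p ^ (m' - card ?F) * (1 - p) ^ (n - m')"
        by (simp only: prod if_True)
    qed blast
    also have "\<dots> = real (card {Y. ?F \<subseteq> Y \<and> Y \<subseteq> ?I \<and> card Y = m'}) *
        (p ^ (m' - card ?F) * (1 - p) ^ (n - m'))"
      by (simp only: sum_constant)
    also have "card {Y. ?F \<subseteq> Y \<and> Y \<subseteq> ?I \<and> card Y = m'} =
        (if card ?F \<le> m' then (card ?I - card ?F) choose (m' - card ?F) else 0)"
      by (rule card_sets_between) auto
    finally show ?thesis
      using False assms(3) num_faulty_le[of n x]
      by (simp only: count_kernel_def T_m_entry num_faulty_eq_card split: if_split) simp
  qed
  finally show ?thesis .
qed

section \<open>Existence of a bounded solution of the Bellman equation\<close>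

lemma finite_cost_bound:
  fixes c :: "nat \<Rightarrow> action \<Rightarrow> real"
  obtains C where "0 \<le> C" "\<And>m u. m \<le> n \<Longrightarrow> \<bar>c m u\<bar> \<le> C"
proof -
  let ?C = "\<Sum>(m, u)\<in>{0..n} \<times> {DoNothing, Inspect, Repair}. \<bar>c m u\<bar>"
  have "\<bar>c m u\<bar> \<le> ?C" if "m \<le> n" for m u
    using member_le_sum[of "(m, u)" "{0..n} \<times> {DoNothing, Inspect, Repair}" "\<lambda>(m, u). \<bar>c m u\<bar>"] that
    by (cases u) auto
  then show ?thesis by (intro that[of ?C]) (auto intro!: sum_nonneg)
qed

text \<open>Averaging with respect to a probability vector does not increase the supremum norm. This
  is what makes the expected continuation value after an inspection nonexpansive in the value
  function.\<close>

lemma abs_weighted_sum_le: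
  fixes w f :: "nat \<Rightarrow> real"
  assumes "\<And>m. m \<le> n \<Longrightarrow> 0 \<le> w m" "(\<Sum>m=0..n. w m) = 1" "\<And>m. m \<le> n \<Longrightarrow> \<bar>f m\<bar> \<le> B"
  shows "\<bar>\<Sum>m=0..n. w m * f m\<bar> \<le> B"
proof -
  have "\<bar>\<Sum>m=0..n. w m * f m\<bar> \<le> (\<Sum>m=0..n. w m * B)"
    using assms by (intro order_trans[OF sum_abs] sum_mono) (auto simp: abs_mult intro: mult_left_mono)
  also have "\<dots> = B" using assms(2) by (simp flip: sum_distrib_right)
  finally show ?thesis .
qed

lemma bellman_rhs_simps:
  "bellman_rhs n p \<beta> c V s z DoNothing = c_hat n p c s z DoNothing + \<beta> * V (s, Suc z)"
  "bellman_rhs n p \<beta> c V s z Inspect = c_hat n p c s z Inspect +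
    \<beta> * (\<Sum>k=0..n. (T_m n p ^\<^sub>m Suc z) $$ (k, s) * V (k, 0))"
  "bellman_rhs n p \<beta> c V s z Repair = c_hat n p c s z Repair + \<beta> * V (0, 0)"
proof -
  have split: "(\<Sum>ob\<in>insert Blank (Count ` {0..n}). F ob) = F Blank + (\<Sum>k=0..n. F (Count k))"
    for F :: "obs \<Rightarrow> real"
    by (subst sum.insert) (auto simp: sum.reindex inj_on_def)
  show "bellman_rhs n p \<beta> c V s z DoNothing = c_hat n p c s z DoNothing + \<beta> * V (s, Suc z)"
    unfolding bellman_rhs_def split by (simp add: obs_prob_def)
  show "bellman_rhs n p \<beta> c V s z Inspect = c_hat n p c s z Inspect +
      \<beta> * (\<Sum>k=0..n. (T_m n p ^\<^sub>m Suc z) $$ (k, s) * V (k, 0))"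
    unfolding bellman_rhs_def split by (simp add: obs_prob_def)
  have "(\<Sum>k=0..n. obs_prob n p (Count k) s z Repair * V (0, 0)) =
      (\<Sum>k=0..n. if k = 0 then V (0, 0) else 0)"
    by (intro sum.cong) (auto simp: obs_prob_def)
  then show "bellman_rhs n p \<beta> c V s z Repair = c_hat n p c s z Repair + \<beta> * V (0, 0)"
    unfolding bellman_rhs_def split by (simp add: obs_prob_def)
qed

lemma abs_c_hat_le:
  assumes "0 \<le> p" "p \<le> 1" "s \<le> n" "\<And>m u. m \<le> n \<Longrightarrow> \<bar>c m u\<bar> \<le> C"
  shows "\<bar>c_hat n p c s z u\<bar> \<le> C"
  unfolding c_hat_def
  using abs_weighted_sum_le[of n "\<lambda>m. (T_m n p ^\<^sub>m z) $$ (m, s)" "\<lambda>m. c m u" C] assms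
  by (simp add: T_m_pow_nonneg T_m_pow_column_sum mult.commute)

lemma bellman_rhs_contraction:
  assumes p: "0 \<le> p" "p \<le> 1" and \<beta>: "0 < \<beta>" and s: "s \<le> n"
    and D: "\<And>k z. k \<le> n \<Longrightarrow> \<bar>V (k, z) - W (k, z)\<bar> \<le> D"
  shows "\<bar>bellman_rhs n p \<beta> c V s z u - bellman_rhs n p \<beta> c W s z u\<bar> \<le> \<beta> * D"
proof (cases u)
  case DoNothing
  then show ?thesis using \<beta> D[OF s]
    by (simp add: bellman_rhs_simps abs_mult flip: right_diff_distrib)
next
  case Inspect
  have "\<bar>\<Sum>k=0..n. (T_m n p ^\<^sub>m Suc z) $$ (k, s) * (V (k, 0) - W (k, 0))\<bar> \<le> D"
    using p s D by (intro abs_weighted_sum_le T_m_pow_nonneg T_m_pow_column_sum)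
  moreover have "bellman_rhs n p \<beta> c V s z u - bellman_rhs n p \<beta> c W s z u =
      \<beta> * (\<Sum>k=0..n. (T_m n p ^\<^sub>m Suc z) $$ (k, s) * (V (k, 0) - W (k, 0)))"
    using Inspect
    by (simp add: bellman_rhs_simps right_diff_distrib sum_subtractf del: pow_mat.simps)
  ultimately show ?thesis using \<beta> by (simp only: abs_mult) simp
next
  case Repair
  then show ?thesis using \<beta> D[of 0 0]
    by (simp add: bellman_rhs_simps abs_mult flip: right_diff_distrib)
qed

lemma abs_Min_image_diff_le:
  fixes f g :: "'a \<Rightarrow> real"
  assumes "finite U" "U \<noteq> {}" "\<And>u. u \<in> U \<Longrightarrow> \<bar>f u - g u\<bar> \<le> D"
  shows "\<bar>Min (f ` U) - Min (g ` U)\<bar> \<le> D"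
proof -
  have half: "Min (a ` U) \<le> Min (b ` U) + D"
    if "\<And>u. u \<in> U \<Longrightarrow> \<bar>a u - b u\<bar> \<le> D" for a b :: "'a \<Rightarrow> real"
  proof -
    have "Min (b ` U) \<in> b ` U" using assms by simp
    then obtain u where u: "u \<in> U" "Min (b ` U) = b u" by auto
    have "Min (a ` U) \<le> a u" using u assms by simp
    then show ?thesis using that[OF u(1)] u(2) by linarith
  qed
  show ?thesis using half[of f g] half[of g f] assms(3) by (fastforce simp: abs_minus_commute)
qed

text \<open>Banach's fixed point theorem for all bounded functions on a set without topology. The iterates
  started at \<open>0\<close> stay within \<open>C / (1 - \<beta>)\<close>, so any two iterates from the
  \<open>k\<close>-th on differ by at most \<open>\<beta> ^ k * C / (1 - \<beta>)\<close>, uniformly in the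
  argument, and the contraction carries this bound over to the pointwise limit.\<close>

lemma sup_norm_contraction_fixpoint:
  fixes \<Gamma> :: "('a \<Rightarrow> real) \<Rightarrow> 'a \<Rightarrow> real"
  assumes \<beta>: "0 \<le> \<beta>" "\<beta> < 1"
    and contr: "\<And>V W D x. (\<And>y. \<bar>V y - W y\<bar> \<le> D) \<Longrightarrow> \<bar>\<Gamma> V x - \<Gamma> W x\<bar> \<le> \<beta> * D"
    and zero: "\<And>x. \<bar>\<Gamma> (\<lambda>_. 0) x\<bar> \<le> C"
  obtains V where "\<And>x. \<bar>V x\<bar> \<le> C / (1 - \<beta>)" "\<Gamma> V = V"
proof -
  let ?W = "\<lambda>k. (\<Gamma> ^^ k) (\<lambda>_. 0)"
  define B where "B = C / (1 - \<beta>)"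
  have B: "\<beta> * B + C = B" using \<beta> by (simp add: B_def field_simps)
  have "0 \<le> C" using zero[of undefined] by linarith
  then have B0: "0 \<le> B" using \<beta> by (simp add: B_def)
  have bound: "\<bar>?W j x\<bar> \<le> B" for j x
  proof (induction j arbitrary: x)
    case (Suc j)
    have "\<bar>\<Gamma> (?W j) x - \<Gamma> (\<lambda>_. 0) x\<bar> \<le> \<beta> * B"
      using Suc by (intro contr) simp
    then show ?case using zero[of x] B by simp
  qed (simp add: B0)
  have close: "\<bar>?W (k + j) x - ?W k x\<bar> \<le> \<beta> ^ k * B" for k j x
  proof (induction k arbitrary: x)
    case (Suc k)
    show ?case using contr[of "?W (k + j)" "?W k", OF Suc] by (simp add: mult.assoc)
  qed (simp add: bound)
  have rate: "(\<lambda>k. \<beta> ^ k * B) \<longlonglongrightarrow> 0"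
    using \<beta> by (intro tendsto_mult_left_zero LIMSEQ_power_zero) simp
  have "Cauchy (\<lambda>k. ?W k x)" for x
    unfolding Cauchy_altdef2
  proof (intro allI impI)
    fix e :: real assume "0 < e"
    then obtain N where "\<beta> ^ N * B < e"
      using order_tendstoD(2)[OF rate] eventually_happens'[OF sequentially_bot] by blast
    then show "\<exists>N. \<forall>k\<ge>N. dist (?W k x) (?W N x) < e"
      using close[of N _ x] by (intro exI[of _ N]) (force simp: dist_real_def le_iff_add intro: le_less_trans)
  qed
  then obtain V where V: "\<And>x. (\<lambda>k. ?W k x) \<longlonglongrightarrow> V x"
    unfolding Cauchy_convergent_iff convergent_def by metis
  have V_close: "\<bar>V x - ?W k x\<bar> \<le> \<beta> ^ k * B" for k x
  proof (rule LIMSEQ_le_const2)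
    show "(\<lambda>j. \<bar>?W (k + j) x - ?W k x\<bar>) \<longlonglongrightarrow> \<bar>V x - ?W k x\<bar>"
      using LIMSEQ_ignore_initial_segment[OF V[of x], of k]
      by (intro tendsto_intros) (simp add: add.commute)
  qed (use close in blast)
  have "\<Gamma> V x = V x" for x
  proof (rule LIMSEQ_unique)
    have "\<bar>?W (Suc k) x - \<Gamma> V x\<bar> \<le> \<beta> ^ Suc k * B" for k
      using contr[of V "?W k", OF V_close[of _ k]] by (simp add: abs_minus_commute mult.assoc)
    then have "(\<lambda>k. ?W (Suc k) x - \<Gamma> V x) \<longlonglongrightarrow> 0"
      by (intro tendsto_rabs_zero_cancel[OF tendsto_sandwich[OF _ _ tendsto_const LIMSEQ_Suc[OF rate]]])
        (auto intro!: always_eventually)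
    then show "(\<lambda>k. ?W (Suc k) x) \<longlonglongrightarrow> \<Gamma> V x" by (simp only: LIM_zero_iff)
    show "(\<lambda>k. ?W (Suc k) x) \<longlonglongrightarrow> V x" by (rule LIMSEQ_Suc[OF V])
  qed
  moreover have "\<bar>V x\<bar> \<le> B" for x using V_close[of x 0] by simp
  ultimately show ?thesis by (intro that[of V]) (auto simp: B_def)
qed

text \<open>The right-hand side of the equation is a contraction in the value function for each single
  action, and a minimum over actions moves by no more than the largest move of its terms.\<close>

lemma bounded_bellman_solution_exists:
  assumes p: "0 \<le> p" "p \<le> 1" and \<beta>: "0 < \<beta>" "\<beta> < 1"
  shows "\<exists>V. bounded_bellman_solution n p \<beta> c V"
proof -
  \<comment> \<open>Outside the relevant domain the operator is set to zero to keep it bounded there.\<close>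
  define \<Gamma> :: "(nat \<times> nat \<Rightarrow> real) \<Rightarrow> nat \<times> nat \<Rightarrow> real" where
    "\<Gamma> V = (\<lambda>(s, z). if s \<le> n
       then MIN u\<in>{DoNothing, Inspect, Repair}. bellman_rhs n p \<beta> c V s z u else 0)" for V
  obtain C where C: "0 \<le> C" "\<And>m u. m \<le> n \<Longrightarrow> \<bar>c m u\<bar> \<le> C"
    using finite_cost_bound[of n c] by blast
  have contr: "\<bar>\<Gamma> V x - \<Gamma> W x\<bar> \<le> \<beta> * D" if D: "\<And>x. \<bar>V x - W x\<bar> \<le> D" for V W D x
  proof (cases x)
    case (Pair s z)
    have "\<bar>(MIN u\<in>{DoNothing, Inspect, Repair}. bellman_rhs n p \<beta> c V s z u) -
        (MIN u\<in>{DoNothing, Inspect, Repair}. bellman_rhs n p \<beta> c W s z u)\<bar> \<le> \<beta> * D" if "s \<le> n"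
      using p \<beta> D that by (intro abs_Min_image_diff_le bellman_rhs_contraction) auto
    then show ?thesis using Pair \<beta> order_trans[OF abs_ge_zero D] unfolding \<Gamma>_def by auto
  qed
  have zero: "\<bar>\<Gamma> (\<lambda>_. 0) x\<bar> \<le> C" for x
  proof (cases x)
    case (Pair s z)
    have "\<bar>Min ((bellman_rhs n p \<beta> c (\<lambda>_. 0) s z) ` {DoNothing, Inspect, Repair}) -
        Min ((\<lambda>_. 0) ` {DoNothing, Inspect, Repair})\<bar> \<le> C" if "s \<le> n"
      using abs_c_hat_le[OF p that C(2)]
      by (intro abs_Min_image_diff_le) (auto simp: bellman_rhs_simps)
    then show ?thesis using C(1) Pair by (simp add: \<Gamma>_def)
  qed
  obtain V where bound: "\<And>x. \<bar>V x\<bar> \<le> C / (1 - \<beta>)" and fixpoint: "\<Gamma> V = V"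
    using sup_norm_contraction_fixpoint[of \<beta> \<Gamma> C, OF less_imp_le[OF \<beta>(1)] \<beta>(2) contr zero] by blast
  have "bounded_bellman_solution n p \<beta> c V"
    unfolding bounded_bellman_solution_def
  proof (intro conjI ballI allI)
    show "bounded (V ` ({0..n} \<times> UNIV))"
      using bound by (auto simp: bounded_iff)
    fix s z assume "s \<in> {0..n}"
    then show "V (s, z) = (MIN u\<in>{DoNothing, Inspect, Repair}. bellman_rhs n p \<beta> c V s z u)"
      by (subst fixpoint[symmetric]) (simp add: \<Gamma>_def)
  qed
  then show ?thesis by blast
qed

section \<open>Expectations of functions of finitely many states\<close>

text \<open>Measurability with respect to the states at the times \<open>0, \<dots>, t\<close>, for a function
  of the path. As there are finitely many joint states, such a function takes finitely many
  values on the path space, which makes its expectation a finite sum over histories.\<close>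

definition depends_upto :: "nat \<Rightarrow> ((nat \<Rightarrow> nat \<Rightarrow> bool) \<Rightarrow> 'a) \<Rightarrow> bool" where
  "depends_upto t F \<longleftrightarrow> (\<forall>\<omega> \<omega>'. (\<forall>s\<le>t. \<omega> s = \<omega>' s) \<longrightarrow> F \<omega> = F \<omega>')"

lemma depends_upto_info [simp]: "depends_upto t (\<lambda>\<omega>. info n g \<omega> t)"
  unfolding depends_upto_def by (blast intro: info_cong)

lemma depends_upto_state [simp]: "s \<le> t \<Longrightarrow> depends_upto t (\<lambda>\<omega>. \<omega> s)"
  by (simp add: depends_upto_def)

lemma depends_upto_compose: "depends_upto t F \<Longrightarrow> depends_upto t (\<lambda>\<omega>. f (F \<omega>))"
  unfolding depends_upto_def by metis

lemma depends_upto_compose2: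
  "depends_upto t F \<Longrightarrow> depends_upto t G \<Longrightarrow> depends_upto t (\<lambda>\<omega>. f (F \<omega>) (G \<omega>))"
  unfolding depends_upto_def by metis

definition cylinder :: "nat \<Rightarrow> nat \<Rightarrow> (nat \<Rightarrow> nat \<Rightarrow> bool) \<Rightarrow> (nat \<Rightarrow> nat \<Rightarrow> bool) set" where
  "cylinder n t h = {\<omega> \<in> space (PiM UNIV (\<lambda>_. states n)). \<forall>s\<le>t. \<omega> s = h s}"

definition histories :: "nat \<Rightarrow> nat \<Rightarrow> (nat \<Rightarrow> nat \<Rightarrow> bool) set" where
  "histories n t = PiE {..t} (\<lambda>_. space (states n))"

lemma finite_space_states: "finite (space (states n))"
  using finite_joint_states by (simp add: space_states)

lemma finite_histories: "finite (histories n t)"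
  unfolding histories_def by (intro finite_PiE finite_space_states) simp

lemma cylinder_measurable: "cylinder n t h \<in> sets (path_measure n p g)"
proof -
  have "(\<lambda>\<omega>. \<omega> s) -` ({h s} \<inter> space (states n)) \<inter> space (PiM UNIV (\<lambda>_. states n))
      \<in> sets (PiM UNIV (\<lambda>_. states n))" for s
    by (rule measurable_sets[OF measurable_component_singleton])
      (auto simp: states_eq)
  note meas = this
  have eq: "cylinder n t h = (\<Inter>s\<in>{..t}.
      (\<lambda>\<omega>. \<omega> s) -` ({h s} \<inter> space (states n)) \<inter> space (PiM UNIV (\<lambda>_. states n)))"
    by (auto simp: cylinder_def space_PiM)
  show ?thesis
    unfolding sets_path_measure eq by (rule sets.finite_INT[OF _ _ meas]) auto
qed

lemma depends_upto_eq_sum_cylinders: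
  fixes F :: "(nat \<Rightarrow> nat \<Rightarrow> bool) \<Rightarrow> real"
  assumes F: "depends_upto t F" and \<omega>: "\<omega> \<in> space (path_measure n p g)"
  shows "F \<omega> = (\<Sum>h\<in>histories n t. F h * indicator (cylinder n t h) \<omega>)"
proof -
  let ?h = "restrict \<omega> {..t}"
  have mem: "\<omega> s \<in> space (states n)" for s
    using \<omega> by (auto simp: space_path_measure space_PiM)
  have "\<omega> \<in> cylinder n t h \<longleftrightarrow> h = ?h" if "h \<in> histories n t" for h
    using that \<omega> by (auto simp: cylinder_def histories_def space_path_measure PiE_iff
        extensional_def fun_eq_iff)
  then have "(\<Sum>h\<in>histories n t. F h * indicator (cylinder n t h) \<omega>) =
      (\<Sum>h\<in>histories n t. if h = ?h then F ?h else 0)"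
    by (intro sum.cong) (auto simp: indicator_def)
  also have "\<dots> = F ?h"
    using mem finite_histories[of n t] by (subst sum.delta) (auto simp: histories_def)
  also have "F ?h = F \<omega>"
    using F unfolding depends_upto_def by (metis atMost_iff restrict_apply')
  finally show ?thesis by simp
qed

lemma
  fixes F :: "(nat \<Rightarrow> nat \<Rightarrow> bool) \<Rightarrow> real"
  assumes F: "depends_upto t F"
  shows integrable_depends_upto: "integrable (path_measure n p g) F"
    and integral_depends_upto: "(\<integral>\<omega>. F \<omega> \<partial>path_measure n p g) =
      (\<Sum>h\<in>histories n t. F h * measure (path_measure n p g) (cylinder n t h))"
proof -
  interpret prob_space "path_measure n p g" by (rule prob_space_path_measure)
  have int: "integrable (path_measure n p g) (\<lambda>\<omega>. F h * indicator (cylinder n t h) \<omega>)" for h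
    by (intro integrable_mult_right integrable_real_indicator cylinder_measurable)
      (simp add: emeasure_eq_measure)
  have eq: "\<And>\<omega>. \<omega> \<in> space (path_measure n p g) \<Longrightarrow>
      F \<omega> = (\<Sum>h\<in>histories n t. F h * indicator (cylinder n t h) \<omega>)"
    by (rule depends_upto_eq_sum_cylinders[OF F])
  show "integrable (path_measure n p g) F"
    by (subst Bochner_Integration.integrable_cong[OF refl eq]) (auto intro!: integrable_sum int simp del: integrable_mult_right_iff)
  have "(\<integral>\<omega>. F \<omega> \<partial>path_measure n p g) =
      (\<integral>\<omega>. (\<Sum>h\<in>histories n t. F h * indicator (cylinder n t h) \<omega>) \<partial>path_measure n p g)"
    by (rule Bochner_Integration.integral_cong[OF refl eq])
  also have "\<dots> = (\<Sum>h\<in>histories n t. \<integral>\<omega>. F h * indicator (cylinder n t h) \<omega> \<partial>path_measure n p g)"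
    by (rule Bochner_Integration.integral_sum[OF int])
  also have "\<dots> = (\<Sum>h\<in>histories n t. F h * measure (path_measure n p g) (cylinder n t h))"
    using sets.sets_into_space[OF cylinder_measurable, of n t _ p g]
    by (intro sum.cong) (auto simp: Int_absorb2)
  finally show "(\<integral>\<omega>. F \<omega> \<partial>path_measure n p g) =
      (\<Sum>h\<in>histories n t. F h * measure (path_measure n p g) (cylinder n t h))" .
qed

lemma sum_histories_Suc:
  "(\<Sum>h\<in>histories n (Suc t). G h) =
    (\<Sum>h\<in>histories n t. \<Sum>y\<in>space (states n). G (h(Suc t := y)))"
proof -
  have "(\<Sum>h\<in>histories n (Suc t). G h) =
      (\<Sum>(h, y)\<in>histories n t \<times> space (states n). G (h(Suc t := y)))"
  proof (rule sum.reindex_bij_witness[where i = "\<lambda>(h, y). h(Suc t := y)"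
        and j = "\<lambda>h. (restrict h {..t}, h (Suc t))"])
    fix h assume h: "h \<in> histories n (Suc t)"
    show eq: "(case (restrict h {..t}, h (Suc t)) of (h, y) \<Rightarrow> h(Suc t := y)) = h"
      using h by (auto simp: histories_def PiE_iff extensional_def fun_eq_iff le_Suc_eq)
    show "(restrict h {..t}, h (Suc t)) \<in> histories n t \<times> space (states n)"
      using h by (auto simp: histories_def PiE_iff)
    show "(case (restrict h {..t}, h (Suc t)) of (h, y) \<Rightarrow> G (h(Suc t := y))) = G h"
      using eq by simp
  next
    fix hy assume "hy \<in> histories n t \<times> space (states n)"
    then show "(restrict (case hy of (h, y) \<Rightarrow> h(Suc t := y)) {..t},
        (case hy of (h, y) \<Rightarrow> h(Suc t := y)) (Suc t)) = hy"
      "(case hy of (h, y) \<Rightarrow> h(Suc t := y)) \<in> histories n (Suc t)"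
      by (auto simp: histories_def PiE_iff extensional_def fun_eq_iff le_Suc_eq)
  qed
  then show ?thesis by (simp add: sum.cartesian_product)
qed

text \<open>The Markov property of the count, in integrated form: \<open>F\<close> plays the role of an
  arbitrary test function of the past. Both sides are sums over histories; in the left one the
  last state is split off and summed with its conditional law given the history.\<close>

lemma expectation_next_count:
  fixes F :: "(nat \<Rightarrow> nat \<Rightarrow> bool) \<Rightarrow> real"
  assumes p: "0 \<le> p" "p \<le> 1" and m': "m' \<le> n" and F: "depends_upto t F"
  shows "(\<integral>\<omega>. F \<omega> * of_bool (num_faulty n (\<omega> (Suc t)) = m') \<partial>path_measure n p g) =
    (\<integral>\<omega>. F \<omega> * count_kernel n p (act n g \<omega> t) m' (num_faulty n (\<omega> t)) \<partial>path_measure n p g)"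
proof -
  let ?P = "path_measure n p g" and ?S = "space (states n)"
  let ?w = "\<lambda>h y. \<Prod>i=1..n. pmf (component_step p (h t i) (act n g h t)) (y i)"
  have law: "measure ?P (cylinder n (Suc t) (h(Suc t := y))) = measure ?P (cylinder n t h) * ?w h y"
    if h: "h \<in> histories n t" and y: "y \<in> ?S" for h y
  proof -
    have "measure ?P (cylinder n (Suc t) (h(Suc t := y))) = measure ?P (cylinder n t (h(Suc t := y))) *
        (\<Prod>i=1..n. pmf (component_step p ((h(Suc t := y)) t i) (act n g (h(Suc t := y)) t))
          ((h(Suc t := y)) (Suc t) i))"
      unfolding cylinder_def space_path_measure[symmetric, of n p g]
      using h y by (intro path_measure_conditional_law) (auto simp: histories_def)
    moreover have "act n g (h(Suc t := y)) t = act n g h t" by (rule act_cong) auto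
    moreover have "cylinder n t (h(Suc t := y)) = cylinder n t h" by (auto simp: cylinder_def)
    ultimately show ?thesis by simp
  qed
  have past: "F (h(Suc t := y)) = F h" for h y
  proof -
    have "\<forall>s\<le>t. (h(Suc t := y)) s = h s" by auto
    then show ?thesis using F unfolding depends_upto_def by blast
  qed
  have dep1: "depends_upto (Suc t) (\<lambda>\<omega>. F \<omega> * of_bool (num_faulty n (\<omega> (Suc t)) = m'))"
    using F by (auto simp: depends_upto_def)
  have dep: "depends_upto t (\<lambda>\<omega>. F \<omega> * count_kernel n p (act n g \<omega> t) m' (num_faulty n (\<omega> t)))"
    unfolding depends_upto_def
  proof (intro allI impI)
    fix \<omega> \<omega>' :: "nat \<Rightarrow> nat \<Rightarrow> bool" assume eq: "\<forall>s\<le>t. \<omega> s = \<omega>' s"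
    moreover have "act n g \<omega> t = act n g \<omega>' t" using eq by (intro act_cong) blast
    moreover have "F \<omega> = F \<omega>'" using F eq unfolding depends_upto_def by blast
    ultimately show "F \<omega> * count_kernel n p (act n g \<omega> t) m' (num_faulty n (\<omega> t)) =
        F \<omega>' * count_kernel n p (act n g \<omega>' t) m' (num_faulty n (\<omega>' t))" by simp
  qed
  have "(\<integral>\<omega>. F \<omega> * of_bool (num_faulty n (\<omega> (Suc t)) = m') \<partial>?P) =
      (\<Sum>h\<in>histories n t. \<Sum>y\<in>?S. F h * of_bool (num_faulty n y = m') *
        (measure ?P (cylinder n t h) * ?w h y))"
    by (simp add: integral_depends_upto[OF dep1] sum_histories_Suc law past)
  also have "\<dots> = (\<Sum>h\<in>histories n t. F h * measure ?P (cylinder n t h) *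
      (\<Sum>y\<in>{y\<in>?S. num_faulty n y = m'}. ?w h y))"
    unfolding sum_distrib_left using finite_space_states[of n]
    by (intro sum.cong sum.mono_neutral_cong_right) (auto simp: mult_ac)
  also have "\<dots> = (\<Sum>h\<in>histories n t. F h * measure ?P (cylinder n t h) *
      count_kernel n p (act n g h t) m' (num_faulty n (h t)))"
    by (simp only: num_faulty_step_law[OF p m'])
  also have "\<dots> = (\<integral>\<omega>. F \<omega> * count_kernel n p (act n g \<omega> t) m' (num_faulty n (\<omega> t)) \<partial>?P)"
    by (simp add: integral_depends_upto[OF dep] mult_ac)
  finally show ?thesis .
qed

section \<open>The information state as a filter\<close>

type_synonym information = "obs list \<times> action list"

text \<open>One step of the information, separated from the path that produces the observation, so that
  hypothetical observations can be appended as well.\<close>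

definition extend_info :: "information \<Rightarrow> action \<Rightarrow> obs \<Rightarrow> information" where
  "extend_info I u ob = (fst I @ [ob], snd I @ [u])"

lemma info_Suc_eq_extend:
  "info n g \<omega> (Suc t) =
    extend_info (info n g \<omega> t) (act n g \<omega> t) (observe (act n g \<omega> t) (num_faulty n (\<omega> (Suc t))))"
  by (simp add: extend_info_def act_def Let_def split: prod.split)

definition info_state :: "information \<Rightarrow> nat \<times> nat" where
  "info_state I = (last_obs (fst I), elapsed (fst I))"

lemma info_state_initial: "info_state ([Count 0], []) = (0, 0)"
  by (simp add: info_state_def last_obs_def elapsed_def)

lemma info_state_extend:
  "info_state (extend_info I u Blank) = (fst (info_state I), Suc (snd (info_state I)))"
  "info_state (extend_info I u (Count k)) = (k, 0)"
  by (simp_all add: info_state_def extend_info_def last_obs_def elapsed_def)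

lemma info_state_le: "fst (info_state (info n g \<omega> t)) \<le> n"
proof (induction t)
  case (Suc t)
  then show ?case
    by (cases "act n g \<omega> t") (auto simp: info_Suc_eq_extend info_state_extend num_faulty_le
        simp del: info.simps)
qed (simp add: info_state_initial)

text \<open>The conditional law of the current count given the information; that it is one is the content
  of \<open>filter_expectation\<close> below.\<close>

definition belief :: "nat \<Rightarrow> real \<Rightarrow> information \<Rightarrow> nat \<Rightarrow> real" where
  "belief n p I m = (T_m n p ^\<^sub>m snd (info_state I)) $$ (m, fst (info_state I))"

definition predict :: "nat \<Rightarrow> real \<Rightarrow> information \<Rightarrow> action \<Rightarrow> nat \<Rightarrow> real" where
  "predict n p I u k = (\<Sum>m=0..n. count_kernel n p u k m * belief n p I m)"

lemma predict_eq:
  assumes "fst (info_state I) \<le> n" "k \<le> n"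
  shows "predict n p I u k = (if u = Repair then of_bool (k = 0)
    else (T_m n p ^\<^sub>m Suc (snd (info_state I))) $$ (k, fst (info_state I)))"
proof (cases "u = Repair")
  case True
  then show ?thesis
    using T_m_pow_column_sum[OF assms(1), of p "snd (info_state I)"]
    by (simp add: predict_def belief_def count_kernel_def flip: sum_distrib_left)
next
  case False
  then show ?thesis
    using T_m_pow_Suc[OF assms(2,1)] by (simp add: predict_def belief_def count_kernel_def)
qed

lemma predict_column_sum:
  assumes "fst (info_state I) \<le> n"
  shows "(\<Sum>k=0..n. predict n p I u k) = 1"
proof -
  have "(\<Sum>k=0..n. predict n p I u k) = (\<Sum>k=0..n. if u = Repair then if k = 0 then 1 else 0
      else (T_m n p ^\<^sub>m Suc (snd (info_state I))) $$ (k, fst (info_state I)))"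
    using assms by (intro sum.cong) (auto simp only: predict_eq atLeastAtMost_iff of_bool_def)
  then show ?thesis
    using T_m_pow_column_sum[OF assms] by (cases "u = Repair") (simp_all del: pow_mat.simps)
qed

text \<open>Bayes' rule for the belief: the joint law of the next count and the next information can be
  drawn at once, or by drawing the next information first and then the count from the updated
  belief. If the observation is blank, the updated belief is the prediction itself, whatever the
  drawn count was. Otherwise the updated belief is a point mass at the observed count, which is the
  drawn count with probability one; after a repair this uses that the prediction is concentrated
  at \<open>0\<close>.\<close>

lemma belief_update:
  assumes "fst (info_state I) \<le> n"
  shows "(\<Sum>k=0..n. \<psi> k (extend_info I u (observe u k)) * predict n p I u k) =
    (\<Sum>k=0..n. (\<Sum>j=0..n. \<psi> j (extend_info I u (observe u k)) *
        belief n p (extend_info I u (observe u k)) j) * predict n p I u k)"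
proof (cases "u = DoNothing")
  case True
  let ?I' = "extend_info I DoNothing Blank"
  have new: "belief n p ?I' j = predict n p I u j" if "j \<le> n" for j
    using predict_eq[OF assms that, of p u] True
    by (simp add: belief_def info_state_extend)
  have "(\<Sum>k=0..n. (\<Sum>j=0..n. \<psi> j ?I' * belief n p ?I' j) * predict n p I u k) =
      (\<Sum>j=0..n. \<psi> j ?I' * belief n p ?I' j)"
    using predict_column_sum[OF assms, of p u] by (simp flip: sum_distrib_left)
  then show ?thesis using True new by simp
next
  case False
  have new: "belief n p (extend_info I u (observe u k)) j =
      of_bool (j = the_count (observe u k))" if "j \<le> n" "k \<le> n" for j k
    using that False T_m_pow_0[of j n _ p]
    by (cases u) (simp_all add: belief_def info_state_extend del: pow_mat.simps)
  show ?thesis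
  proof (rule sum.cong[OF refl])
    fix k assume k: "k \<in> {0..n}"
    have "(\<Sum>j=0..n. \<psi> j (extend_info I u (observe u k)) *
        belief n p (extend_info I u (observe u k)) j) =
        (\<Sum>j=0..n. if j = the_count (observe u k) then \<psi> j (extend_info I u (observe u k)) else 0)"
      using k by (intro sum.cong) (auto simp: new)
    also have "\<dots> = \<psi> (the_count (observe u k)) (extend_info I u (observe u k))"
      using k False by (cases u) auto
    finally show "\<psi> k (extend_info I u (observe u k)) * predict n p I u k =
        (\<Sum>j=0..n. \<psi> j (extend_info I u (observe u k)) *
          belief n p (extend_info I u (observe u k)) j) * predict n p I u k"
      using False predict_eq[OF assms, of k p u] k by (cases u; cases "k = 0") auto
  qed
qed

lemma integrable_count_info:
  "integrable (path_measure n p g) (\<lambda>\<omega>. \<psi> (num_faulty n (\<omega> t)) (info n g \<omega> t) :: real)"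
proof (rule integrable_depends_upto)
  show "depends_upto t (\<lambda>\<omega>. \<psi> (num_faulty n (\<omega> t)) (info n g \<omega> t))"
    by (rule depends_upto_compose2[OF depends_upto_compose[OF depends_upto_state[OF order_refl]]
          depends_upto_info])
qed

lemma integrable_info:
  "integrable (path_measure n p g) (\<lambda>\<omega>. \<psi> (info n g \<omega> t) :: real)"
  by (rule integrable_count_info[of _ _ _ "\<lambda>_. \<psi>"])

lemma act_eq_info: "act n g \<omega> t = case_prod g (info n g \<omega> t)"
  by (simp add: act_def)

text \<open>If the belief is the correct filter at time \<open>t\<close>, the prediction is the correct
  conditional law of the next count. The hypothesis is a formula for all test functions because
  it is the induction hypothesis of \<open>filter_expectation\<close>.\<close>

lemma next_expectation_given_filter:
  fixes \<psi> :: "nat \<Rightarrow> information \<Rightarrow> real"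
  assumes p: "0 \<le> p" "p \<le> 1"
    and filter: "\<And>\<phi> :: nat \<Rightarrow> information \<Rightarrow> real.
      (\<integral>\<omega>. \<phi> (num_faulty n (\<omega> t)) (info n g \<omega> t) \<partial>path_measure n p g) =
      (\<integral>\<omega>. (\<Sum>m=0..n. \<phi> m (info n g \<omega> t) * belief n p (info n g \<omega> t) m) \<partial>path_measure n p g)"
  shows "(\<integral>\<omega>. \<psi> (num_faulty n (\<omega> (Suc t))) (info n g \<omega> (Suc t)) \<partial>path_measure n p g) =
    (\<integral>\<omega>. (\<Sum>k=0..n. \<psi> k (extend_info (info n g \<omega> t) (act n g \<omega> t) (observe (act n g \<omega> t) k)) *
      predict n p (info n g \<omega> t) (act n g \<omega> t) k) \<partial>path_measure n p g)"
proof -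
  let ?P = "path_measure n p g"
  define \<psi>' where "\<psi>' k I = \<psi> k (extend_info I (case_prod g I) (observe (case_prod g I) k))" for k I
  have split: "\<psi> (num_faulty n (\<omega> (Suc t))) (info n g \<omega> (Suc t)) =
      (\<Sum>k=0..n. \<psi>' k (info n g \<omega> t) * of_bool (num_faulty n (\<omega> (Suc t)) = k))" for \<omega>
  proof -
    have "(\<Sum>k=0..n. \<psi>' k (info n g \<omega> t) * of_bool (num_faulty n (\<omega> (Suc t)) = k)) =
        (\<Sum>k=0..n. if k = num_faulty n (\<omega> (Suc t)) then \<psi>' k (info n g \<omega> t) else 0)"
      by (intro sum.cong) auto
    then show ?thesis
      using num_faulty_le[of n "\<omega> (Suc t)"]
      by (simp add: \<psi>'_def info_Suc_eq_extend act_eq_info del: info.simps)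
  qed
  have dep: "depends_upto t (\<lambda>\<omega>. \<psi>' k (info n g \<omega> t))" for k
    by (rule depends_upto_compose[OF depends_upto_info])
  have "(\<integral>\<omega>. \<psi> (num_faulty n (\<omega> (Suc t))) (info n g \<omega> (Suc t)) \<partial>?P) =
      (\<Sum>k=0..n. \<integral>\<omega>. \<psi>' k (info n g \<omega> t) * of_bool (num_faulty n (\<omega> (Suc t)) = k) \<partial>?P)"
    unfolding split
  proof (rule Bochner_Integration.integral_sum)
    fix k
    show "integrable ?P (\<lambda>\<omega>. \<psi>' k (info n g \<omega> t) * of_bool (num_faulty n (\<omega> (Suc t)) = k))"
      using dep[of k] by (intro integrable_depends_upto[of "Suc t"]) (auto simp: depends_upto_def)
  qed
  also have "\<dots> = (\<Sum>k=0..n. \<integral>\<omega>. \<psi>' k (info n g \<omega> t) *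
      count_kernel n p (act n g \<omega> t) k (num_faulty n (\<omega> t)) \<partial>?P)"
    using p by (intro sum.cong expectation_next_count dep) auto
  also have "\<dots> = (\<Sum>k=0..n. \<integral>\<omega>. \<psi>' k (info n g \<omega> t) *
      predict n p (info n g \<omega> t) (act n g \<omega> t) k \<partial>?P)"
    unfolding act_eq_info predict_def
    by (subst filter[of "\<lambda>m I. \<psi>' _ I * count_kernel n p (case_prod g I) _ m"])
      (simp add: sum_distrib_left mult.assoc)
  also have "\<dots> = (\<integral>\<omega>. (\<Sum>k=0..n. \<psi>' k (info n g \<omega> t) *
      predict n p (info n g \<omega> t) (act n g \<omega> t) k) \<partial>?P)"
    unfolding act_eq_info
    by (rule Bochner_Integration.integral_sum[symmetric])
      (rule integrable_info[of n p g "\<lambda>I. \<psi>' _ I * predict n p I (case_prod g I) _"])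
  finally show ?thesis by (simp only: \<psi>'_def act_eq_info)
qed

text \<open>By induction over time. Initially the count is known to be \<open>0\<close>. In the step, both sides
  are rewritten as expectations over the information at time \<open>t\<close>, where they agree by
  \<open>belief_update\<close>.\<close>

lemma filter_expectation:
  fixes \<psi> :: "nat \<Rightarrow> information \<Rightarrow> real"
  assumes p: "0 \<le> p" "p \<le> 1"
  shows "(\<integral>\<omega>. \<psi> (num_faulty n (\<omega> t)) (info n g \<omega> t) \<partial>path_measure n p g) =
    (\<integral>\<omega>. (\<Sum>m=0..n. \<psi> m (info n g \<omega> t) * belief n p (info n g \<omega> t) m) \<partial>path_measure n p g)"
proof (induction t arbitrary: \<psi>)
  case 0
  show ?case
  proof (rule integral_cong_AE)
    show "AE \<omega> in path_measure n p g. \<psi> (num_faulty n (\<omega> 0)) (info n g \<omega> 0) =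
        (\<Sum>m=0..n. \<psi> m (info n g \<omega> 0) * belief n p (info n g \<omega> 0) m)"
      using path_measure_initial
    proof eventually_elim
      case (elim \<omega>)
      have "(\<Sum>m=0..n. \<psi> m (info n g \<omega> 0) * belief n p (info n g \<omega> 0) m) =
          (\<Sum>m=0..n. if m = 0 then \<psi> 0 (info n g \<omega> 0) else 0)"
        using T_m_pow_0[of _ n 0 p]
        by (intro sum.cong) (auto simp: belief_def info_state_initial simp del: pow_mat.simps)
      moreover have "num_faulty n (\<omega> 0) = 0" unfolding elim by (simp add: num_faulty_def)
      ultimately show ?case by simp
    qed
  qed (rule borel_measurable_integrable, rule integrable_count_info integrable_info)+
next
  case (Suc t)
  let ?P = "path_measure n p g"
  let ?post = "\<lambda>I. \<Sum>m=0..n. \<psi> m I * belief n p I m"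
  let ?next = "\<lambda>\<omega> k. extend_info (info n g \<omega> t) (act n g \<omega> t) (observe (act n g \<omega> t) k)"
  let ?pred = "\<lambda>\<omega>. predict n p (info n g \<omega> t) (act n g \<omega> t)"
  have "(\<integral>\<omega>. \<psi> (num_faulty n (\<omega> (Suc t))) (info n g \<omega> (Suc t)) \<partial>?P) =
      (\<integral>\<omega>. (\<Sum>k=0..n. \<psi> k (?next \<omega> k) * ?pred \<omega> k) \<partial>?P)"
    by (rule next_expectation_given_filter[OF p Suc])
  also have "\<dots> = (\<integral>\<omega>. (\<Sum>k=0..n. ?post (?next \<omega> k) * ?pred \<omega> k) \<partial>?P)"
    by (intro Bochner_Integration.integral_cong refl belief_update info_state_le)
  also have "\<dots> = (\<integral>\<omega>. ?post (info n g \<omega> (Suc t)) \<partial>?P)"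
    by (rule next_expectation_given_filter[OF p Suc, of "\<lambda>_. ?post", symmetric])
  finally show ?case .
qed

text \<open>The observation probabilities of the Bellman equation are the images of the predicted law of
  the next count under the observation map, so the expectation over observations is one over
  counts.\<close>

lemma bellman_rhs_predict:
  assumes "info_state I = (s, z)" "s \<le> n"
  shows "bellman_rhs n p \<beta> c V s z u =
    (\<Sum>m=0..n. c m u * belief n p I m) +
    \<beta> * (\<Sum>k=0..n. V (info_state (extend_info I u (observe u k))) * predict n p I u k)"
proof -
  have "(\<Sum>m=0..n. c m u * belief n p I m) = c_hat n p c s z u"
    using assms by (simp add: c_hat_def belief_def)
  moreover have "bellman_rhs n p \<beta> c V s z u = c_hat n p c s z u +
      \<beta> * (\<Sum>k=0..n. V (info_state (extend_info I u (observe u k))) * predict n p I u k)"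
  proof (cases u)
    case DoNothing
    then show ?thesis
      using predict_column_sum[of I n p u] assms
      by (simp add: bellman_rhs_simps info_state_extend flip: sum_distrib_left)
  next
    case Inspect
    have "(\<Sum>k=0..n. (T_m n p ^\<^sub>m Suc z) $$ (k, s) * V (k, 0)) =
        (\<Sum>k=0..n. V (info_state (extend_info I u (observe u k))) * predict n p I u k)"
      using assms Inspect predict_eq[of I n _ p u]
      by (intro sum.cong) (auto simp: info_state_extend simp del: pow_mat.simps)
    then show ?thesis using Inspect by (simp only: bellman_rhs_simps)
  next
    case Repair
    then show ?thesis
      using predict_column_sum[of I n p u] assms
      by (simp add: bellman_rhs_simps info_state_extend flip: sum_distrib_left)
  qed
  ultimately show ?thesis by simp
qed

section \<open>Verification of optimality\<close>

definition stage_cost ::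
  "nat \<Rightarrow> real \<Rightarrow> (nat \<Rightarrow> action \<Rightarrow> real) \<Rightarrow> strategy \<Rightarrow> nat \<Rightarrow> real" where
  "stage_cost n p c g t = (\<integral>\<omega>. c (num_faulty n (\<omega> t)) (act n g \<omega> t) \<partial>path_measure n p g)"

text \<open>The filter identifies both parts of the right-hand side: the estimated cost has the same
  expectation as the true stage cost, and the estimated continuation value is that of the next
  information state.\<close>

lemma expected_bellman_rhs:
  assumes p: "0 \<le> p" "p \<le> 1"
  shows "(\<integral>\<omega>. (case info_state (info n g \<omega> t) of (s, z) \<Rightarrow>
        bellman_rhs n p \<beta> c V s z (act n g \<omega> t)) \<partial>path_measure n p g) =
    stage_cost n p c g t + \<beta> * (\<integral>\<omega>. V (info_state (info n g \<omega> (Suc t))) \<partial>path_measure n p g)"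
proof -
  let ?P = "path_measure n p g"
  let ?a = "\<lambda>\<omega>. \<Sum>m=0..n. c m (act n g \<omega> t) * belief n p (info n g \<omega> t) m"
  let ?b = "\<lambda>\<omega>. \<Sum>k=0..n. V (info_state (extend_info (info n g \<omega> t) (act n g \<omega> t)
      (observe (act n g \<omega> t) k))) * predict n p (info n g \<omega> t) (act n g \<omega> t) k"
  have rhs: "(case info_state (info n g \<omega> t) of (s, z) \<Rightarrow>
      bellman_rhs n p \<beta> c V s z (act n g \<omega> t)) = ?a \<omega> + \<beta> * ?b \<omega>" for \<omega>
    using info_state_le[of n g \<omega> t] by (auto simp: bellman_rhs_predict split: prod.split)
  have a: "integrable ?P ?a"
    unfolding act_eq_info
    by (rule integrable_info[of n p g "\<lambda>I. \<Sum>m=0..n. c m (case_prod g I) * belief n p I m"])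
  have b: "integrable ?P ?b"
    unfolding act_eq_info
    by (rule integrable_info[of n p g "\<lambda>I. \<Sum>k=0..n. V (info_state (extend_info I (case_prod g I)
      (observe (case_prod g I) k))) * predict n p I (case_prod g I) k"])
  have "(\<integral>\<omega>. ?a \<omega> \<partial>?P) = stage_cost n p c g t"
    unfolding stage_cost_def act_eq_info
    by (rule filter_expectation[OF p, where \<psi> = "\<lambda>m I. c m (case_prod g I)", symmetric])
  moreover have "(\<integral>\<omega>. ?b \<omega> \<partial>?P) = (\<integral>\<omega>. V (info_state (info n g \<omega> (Suc t))) \<partial>?P)"
    by (rule next_expectation_given_filter[OF p filter_expectation[OF p], where \<psi> = "\<lambda>_ I. V (info_state I)", symmetric])
  ultimately show ?thesis
    unfolding rhs using a b by simp
qed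

lemma cost_eq_discounted_stage_costs:
  assumes \<beta>: "0 < \<beta>" "\<beta> < 1"
  shows "(\<lambda>t. \<beta> ^ t * stage_cost n p c g t) sums cost n p \<beta> c g"
proof -
  interpret prob_space "path_measure n p g" by (rule prob_space_path_measure)
  let ?f = "\<lambda>t \<omega>. \<beta> ^ t * c (num_faulty n (\<omega> t)) (act n g \<omega> t)"
  obtain C where C: "0 \<le> C" "\<And>m u. m \<le> n \<Longrightarrow> \<bar>c m u\<bar> \<le> C"
    using finite_cost_bound[of n c] by blast
  have int: "integrable (path_measure n p g) (?f t)" for t
    unfolding act_eq_info
    by (rule integrable_count_info[of n p g "\<lambda>m I. \<beta> ^ t * c m (case_prod g I)"])
  have bound: "norm (?f t \<omega>) \<le> C * \<beta> ^ t" for t \<omega>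
    using \<beta> C(2)[OF num_faulty_le] by (simp add: abs_mult mult.commute)
  have geom: "summable (\<lambda>t. C * \<beta> ^ t)"
    using \<beta> by (intro summable_mult summable_geometric) simp
  have "(\<integral>\<omega>. norm (?f t \<omega>) \<partial>path_measure n p g) \<le> (\<integral>\<omega>. C * \<beta> ^ t \<partial>path_measure n p g)" for t
    using int bound by (intro integral_mono) auto
  then have "(\<lambda>t. \<integral>\<omega>. ?f t \<omega> \<partial>path_measure n p g) sums cost n p \<beta> c g"
    unfolding cost_def using geom bound int
    by (intro sums_integral) (auto intro!: summable_comparison_test'[OF geom] simp: prob_space)
  then show ?thesis by (simp add: stage_cost_def)
qed

text \<open>Telescoping: \<open>(\<Sum>t<N. \<beta> ^ t * e t) + \<beta> ^ N * v N\<close> starts at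
  \<open>v 0\<close>, is monotone or constant in \<open>N\<close> according to the hypothesis, and
  tends to \<open>J\<close> since \<open>v\<close> is bounded.\<close>

lemma discounted_cost_comparison:
  fixes e v :: "nat \<Rightarrow> real"
  assumes \<beta>: "0 < \<beta>" "\<beta> < 1" and v: "\<And>t. \<bar>v t\<bar> \<le> B"
    and e: "(\<lambda>t. \<beta> ^ t * e t) sums J"
  shows "(\<And>t. v t \<le> e t + \<beta> * v (Suc t)) \<Longrightarrow> v 0 \<le> J"
    and "(\<And>t. v t = e t + \<beta> * v (Suc t)) \<Longrightarrow> v 0 = J"
proof -
  let ?r = "\<lambda>N. (\<Sum>t<N. \<beta> ^ t * e t) + \<beta> ^ N * v N"
  have "(\<lambda>N. \<beta> ^ N * v N) \<longlonglongrightarrow> 0"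
  proof (rule Lim_null_comparison)
    show "\<forall>\<^sub>F N in sequentially. norm (\<beta> ^ N * v N) \<le> \<beta> ^ N * B"
      using \<beta> v by (intro always_eventually allI) (simp add: abs_mult)
    show "(\<lambda>N. \<beta> ^ N * B) \<longlonglongrightarrow> 0"
      using \<beta> by (intro tendsto_mult_left_zero LIMSEQ_power_zero) simp
  qed
  from tendsto_add[OF e[unfolded sums_def] this] have lim: "?r \<longlonglongrightarrow> J" by simp
  have step: "?r (Suc N) - ?r N = \<beta> ^ N * (e N + \<beta> * v (Suc N) - v N)" for N
    by (simp add: algebra_simps)
  { assume "\<And>t. v t \<le> e t + \<beta> * v (Suc t)"
    then have nonneg: "0 \<le> \<beta> ^ N * (e N + \<beta> * v (Suc N) - v N)" for N
      using \<beta> by (intro mult_nonneg_nonneg) (auto simp: algebra_simps)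
    have inc: "?r N \<le> ?r (Suc N)" for N using nonneg[of N] step[of N] by linarith
    have "v 0 \<le> ?r N" for N
      by (rule order_trans[OF _ lift_Suc_mono_le[of ?r, OF inc]]) auto
    then show "v 0 \<le> J" by (intro LIMSEQ_le_const[OF lim]) blast }
  { assume eq: "\<And>t. v t = e t + \<beta> * v (Suc t)"
    have "e N + \<beta> * v (Suc N) - v N = 0" for N using eq[of N] by linarith
    with step have "?r (Suc N) - ?r N = 0" for N by (simp only: mult_zero_right)
    then have const: "?r (Suc N) = ?r N" for N by (simp only: right_minus_eq)
    have "?r N = ?r 0" for N by (induction N) (simp_all only: const)
    then have "?r \<longlonglongrightarrow> ?r 0" by (intro tendsto_eventually always_eventually allI)
    then show "v 0 = J" using LIMSEQ_unique[OF _ lim] by simp }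
qed

lemma expectation_initial_info_state:
  "(\<integral>\<omega>. V (info_state (info n g \<omega> 0)) \<partial>path_measure n p g) = (V (0, 0) :: real)"
proof -
  interpret prob_space "path_measure n p g" by (rule prob_space_path_measure)
  show ?thesis by (simp add: info_state_initial prob_space)
qed

lemma bellman_solution_bound:
  assumes "bounded_bellman_solution n p \<beta> c V"
  obtains B where "\<And>g t. \<bar>\<integral>\<omega>. V (info_state (info n g \<omega> t)) \<partial>path_measure n p g\<bar> \<le> B"
proof -
  have "bounded (V ` ({0..n} \<times> UNIV))"
    using assms unfolding bounded_bellman_solution_def by (rule conjunct1)
  then obtain B where "\<And>x. x \<in> V ` ({0..n} \<times> UNIV) \<Longrightarrow> \<bar>x\<bar> \<le> B"
    unfolding bounded_iff real_norm_def by blast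
  then have B: "\<bar>V (info_state (info n g \<omega> t))\<bar> \<le> B" for g \<omega> t
    using info_state_le[of n g \<omega> t] by (cases "info_state (info n g \<omega> t)") auto
  have "\<bar>\<integral>\<omega>. V (info_state (info n g \<omega> t)) \<partial>path_measure n p g\<bar> \<le> B" for g t
  proof -
    interpret prob_space "path_measure n p g" by (rule prob_space_path_measure)
    have "\<bar>\<integral>\<omega>. V (info_state (info n g \<omega> t)) \<partial>path_measure n p g\<bar> \<le>
        (\<integral>\<omega>. \<bar>V (info_state (info n g \<omega> t))\<bar> \<partial>path_measure n p g)"
      by (rule integral_abs_bound)
    also have "\<dots> \<le> (\<integral>\<omega>. B \<partial>path_measure n p g)"
      using B integrable_info[of n p g "\<lambda>I. \<bar>V (info_state I)\<bar>" t] by (intro integral_mono) auto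
    finally show ?thesis by (simp add: prob_space)
  qed
  then show ?thesis by (rule that)
qed

lemma integrable_bellman_rhs:
  "integrable (path_measure n p g) (\<lambda>\<omega>. case info_state (info n g \<omega> t) of (s, z) \<Rightarrow>
    bellman_rhs n p \<beta> c V s z (act n g \<omega> t))"
  unfolding act_eq_info
  by (rule integrable_info[of n p g "\<lambda>I. case info_state I of (s, z) \<Rightarrow>
    bellman_rhs n p \<beta> c V s z (case_prod g I)"])

text \<open>No strategy can beat \<open>V\<close>: its action need not attain the minimum in the Bellman
  equation, so the expectation of \<open>V\<close> exceeds its discounted successor by at most the
  stage cost.\<close>

lemma bellman_solution_le_cost:
  assumes p: "0 \<le> p" "p \<le> 1" and \<beta>: "0 < \<beta>" "\<beta> < 1"
    and V: "bounded_bellman_solution n p \<beta> c V"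
  shows "V (0, 0) \<le> cost n p \<beta> c g"
proof -
  let ?v = "\<lambda>t. \<integral>\<omega>. V (info_state (info n g \<omega> t)) \<partial>path_measure n p g"
  obtain B where B: "\<And>t. \<bar>?v t\<bar> \<le> B" using bellman_solution_bound[OF V] by metis
  have le: "V (s, z) \<le> bellman_rhs n p \<beta> c V s z u" if "s \<le> n" for s z u
    using V that unfolding bounded_bellman_solution_def by (cases u) auto
  have "V (info_state (info n g \<omega> t)) \<le> (case info_state (info n g \<omega> t) of (s, z) \<Rightarrow>
      bellman_rhs n p \<beta> c V s z (act n g \<omega> t))" for \<omega> t
    using info_state_le[of n g \<omega> t] by (auto split: prod.split intro: le)
  then have "?v t \<le> stage_cost n p c g t + \<beta> * ?v (Suc t)" for t
    unfolding expected_bellman_rhs[OF p, symmetric]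
    by (intro integral_mono integrable_bellman_rhs integrable_info[of n p g "\<lambda>I. V (info_state I)"])
  then have "?v 0 \<le> cost n p \<beta> c g"
    by (rule discounted_cost_comparison(1)[OF \<beta> B cost_eq_discounted_stage_costs[OF \<beta>]])
  then show ?thesis by (simp only: expectation_initial_info_state)
qed

lemma minimizer_cost_eq_bellman_solution:
  assumes p: "0 \<le> p" "p \<le> 1" and \<beta>: "0 < \<beta>" "\<beta> < 1"
    and V: "bounded_bellman_solution n p \<beta> c V" and g: "chooses_minimizer n p \<beta> c V g"
  shows "cost n p \<beta> c g = V (0, 0)"
proof -
  let ?v = "\<lambda>t. \<integral>\<omega>. V (info_state (info n g \<omega> t)) \<partial>path_measure n p g"
  obtain B where B: "\<And>t. \<bar>?v t\<bar> \<le> B" using bellman_solution_bound[OF V] by metis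
  have attained: "V (s, z) = bellman_rhs n p \<beta> c V s z u"
    if "s \<le> n" "is_arg_min (bellman_rhs n p \<beta> c V s z) (\<lambda>u. u \<in> {DoNothing, Inspect, Repair}) u"
    for s z u
  proof -
    have "V (s, z) = Min (bellman_rhs n p \<beta> c V s z ` {DoNothing, Inspect, Repair})"
      using V that(1) unfolding bounded_bellman_solution_def by auto
    also have "\<dots> = bellman_rhs n p \<beta> c V s z u"
      using that(2) unfolding is_arg_min_def by (intro Min_eqI) (auto simp: not_less)
    finally show ?thesis .
  qed
  have "?v t = stage_cost n p c g t + \<beta> * ?v (Suc t)" for t
    unfolding expected_bellman_rhs[OF p, symmetric]
  proof (rule integral_cong_AE)
    show "AE \<omega> in path_measure n p g. V (info_state (info n g \<omega> t)) =
        (case info_state (info n g \<omega> t) of (s, z) \<Rightarrow> bellman_rhs n p \<beta> c V s z (act n g \<omega> t))"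
      using g unfolding chooses_minimizer_def
    proof eventually_elim
      case (elim \<omega>)
      then show ?case
        using info_state_le[of n g \<omega> t] by (auto simp: info_state_def Let_def intro: attained)
    qed
    show "(\<lambda>\<omega>. V (info_state (info n g \<omega> t))) \<in> borel_measurable (path_measure n p g)"
      by (rule borel_measurable_integrable, rule integrable_info[of n p g "\<lambda>I. V (info_state I)"])
  qed (rule borel_measurable_integrable, rule integrable_bellman_rhs)
  then have "?v 0 = cost n p \<beta> c g"
    by (rule discounted_cost_comparison(2)[OF \<beta> B cost_eq_discounted_stage_costs[OF \<beta>]])
  then show ?thesis by (simp only: expectation_initial_info_state)
qed

theorem theorem2:
  fixes n :: nat and p \<beta> :: real and c :: "nat \<Rightarrow> action \<Rightarrow> real"
  assumes "1 \<le> n" and "0 \<le> p" "p \<le> 1" and "0 < \<beta>" "\<beta> < 1"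
  shows "(\<exists>V. bounded_bellman_solution n p \<beta> c V) \<and>
    (\<forall>V. bounded_bellman_solution n p \<beta> c V \<longrightarrow>
      (\<forall>g. chooses_minimizer n p \<beta> c V g \<longrightarrow> (\<forall>g'. cost n p \<beta> c g \<le> cost n p \<beta> c g')))"
proof (intro conjI allI impI)
  show "\<exists>V. bounded_bellman_solution n p \<beta> c V"
    using assms by (intro bounded_bellman_solution_exists)
next
  fix V g g'
  assume "bounded_bellman_solution n p \<beta> c V" "chooses_minimizer n p \<beta> c V g"
  then show "cost n p \<beta> c g \<le> cost n p \<beta> c g'"
    using assms minimizer_cost_eq_bellman_solution bellman_solution_le_cost by simp
qed

end
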